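(* Let $x,y$ be two abstract vector variables. Assume $0<q<1$, specialize $Q=q^M$, and let $M\ge1$ be an integer. Then for every $k\ge0$, $$H^{\{y\}}_{k+1}=\ker\Bigl(\partial^{\{y\},\mathrm R}_{x,q}:H^{\{y\}}_{k+1}\to H^{\{y\}}_k\Bigr)\oplus R_xH^{\{y\}}_k$$ holds without determinant localization.
   Context: **Radial algebra (specialized coefficients).** $R(\{x,y\})$ is the associative unital $\mathbb R$-algebra generated by $x,y$ subject to $[\{u,v\},w]=0$ for all $u,v,w\in\{x,y\}$, where $\{a,b\}=ab+ba$, $[a,b]=ab-ba$. Put $w=x\wedge y=\frac12(xy-yx)$. Here $q\in(0,1)$ is a real number and $Q=q^M$, so all coefficients are real. For integers $n$: $[n]_q=\frac{1-q^n}{1-q}$. **Scalars.** $r=x^2$, $s=\{x,y\}$, $t=y^2$ are central, and $R(\{x,y\})$ is free over the polynomial algebra $\mathbb R[r,s,t]$ with basis $1,y,x,w$ (known). **Derivative.** For a scalar variable $u$ and parameter $P$: $\delta^{(u)}_Pf=\frac{f(u)-f(Pu)}{(1-P)u}$, $T^{(u)}_Pf(u)=f(Pu)$. For $f\in\mathbb R[r,s,t]$ put $\partial^{\mathrm{sc}}f=(1+q)\,x\,\delta^{(r)}_{q^2}f+2\,y\,T^{(r)}_{q^2}\delta^{(s)}_qf$. After the specialization, the right $q$-vector derivative $\partial^{\{y\},\mathrm R}_{x,q}$ is the $\mathbb R$-linear operator with $$f\mapsto\partial^{\mathrm{sc}}f,\quad yf\mapsto y\,\partial^{\mathrm{sc}}f,\quad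 xf\mapsto[M]_qf+q^M\,x\,\partial^{\mathrm{sc}}f,\quad wf\mapsto-[M-1]_q\,yf+q^{M-1}\,w\,\partial^{\mathrm{sc}}f .$$ **Blocks.** The $x$-degree is $\deg_xr=2$, $\deg_xs=1$, $\deg_xt=0$, $\deg_x1=\deg_xy=0$, $\deg_xx=\deg_xw=1$. $H^{\{y\}}_k$ is the degree-$k$ component, a finite free $\mathbb R[t]$-module with basis $r^as^b,\ yr^as^b$ ($2a+b=k$) and $xr^as^b,\ wr^as^b$ ($1+2a+b=k$). $R_xF=Fx$ is right multiplication, mapping $H^{\{y\}}_k$ to $H^{\{y\}}_{k+1}$. "Without determinant localization" means that the decomposition holds over $\mathbb R[t]$ itself, without inverting any element. *)

theory Defs
  imports
    Complex_Main
    "HOL-Library.Poly_Mapping"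
    "HOL-Computational_Algebra.Polynomial"
begin

section \<open>The free associative algebra on two vector variables\<close>

datatype vvar = VX | VY

datatype vword = VWord (letters: "vvar list")

instantiation vword :: monoid_add
begin
definition "0 = VWord []"
definition "v + w = VWord (letters v @ letters w)"
instance by standard (simp_all add: zero_vword_def plus_vword_def)
end

lemma vword_add_eq_0_iff: "v + w = 0 \<longleftrightarrow> v = 0 \<and> w = (0 :: vword)"
  by (cases v; cases w) (simp add: zero_vword_def plus_vword_def)

text \<open>Finitely supported functions on words, with the convolution product.\<close>

type_synonym free_alg = "vword \<Rightarrow>\<^sub>0 real"

definition free_var :: "vvar \<Rightarrow> free_alg"
  where "free_var v = Poly_Mapping.single (VWord [v]) 1"

definition commutator :: "'a::ring \<Rightarrow> 'a \<Rightarrow> 'a"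
  where "commutator a b = a * b - b * a"

definition anticommutator :: "'a::ring \<Rightarrow> 'a \<Rightarrow> 'a"
  where "anticommutator a b = a * b + b * a"


section \<open>The radial algebra as a quotient by a two-sided ideal\<close>

inductive_set radial_ideal :: "free_alg set" where
  zero: "0 \<in> radial_ideal"
| gen: "a * commutator (anticommutator (free_var u) (free_var v)) (free_var w) * b \<in> radial_ideal"
| add: "a \<in> radial_ideal \<Longrightarrow> b \<in> radial_ideal \<Longrightarrow> a + b \<in> radial_ideal"

lemma radial_ideal_mult_left: "a \<in> radial_ideal \<Longrightarrow> c * a \<in> radial_ideal"
proof (induction rule: radial_ideal.induct)
  case (gen a u v w b)
  then show ?case
    using radial_ideal.gen[of "c * a" u v w b] by (simp add: mult.assoc)
qed (auto simp: distrib_left intro: radial_ideal.intros)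

lemma radial_ideal_mult_right: "a \<in> radial_ideal \<Longrightarrow> a * c \<in> radial_ideal"
proof (induction rule: radial_ideal.induct)
  case (gen a u v w b)
  then show ?case
    using radial_ideal.gen[of a u v w "b * c"] by (simp add: mult.assoc)
qed (auto simp: distrib_right intro: radial_ideal.intros)

lemma radial_ideal_uminus: "a \<in> radial_ideal \<Longrightarrow> - a \<in> radial_ideal"
  using radial_ideal_mult_left[of a "- 1"] by simp

lemma radial_ideal_diff: "a \<in> radial_ideal \<Longrightarrow> b \<in> radial_ideal \<Longrightarrow> a - b \<in> radial_ideal"
  using radial_ideal.add[OF _ radial_ideal_uminus, of a b] by simp

lemma lookup_times_0:
  "Poly_Mapping.lookup (f * g) 0 = Poly_Mapping.lookup f 0 * Poly_Mapping.lookup g 0"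
  for f g :: free_alg
proof -
  have "(Sum_any (\<lambda>m. Poly_Mapping.lookup g m when 0 = l + m))
      = (Poly_Mapping.lookup g 0 when l = 0)" for l
  proof (cases "l = 0")
    case True
    then show ?thesis using Sum_any_when_equal[of "Poly_Mapping.lookup g" 0] by simp
  next
    case False
    then have "0 \<noteq> l + m" for m using vword_add_eq_0_iff[of l m] by auto
    then show ?thesis using False by simp
  qed
  then show ?thesis
    by (simp add: times_poly_mapping.rep_eq prod_fun_def mult_when)
qed

lemma radial_ideal_lookup_0: "a \<in> radial_ideal \<Longrightarrow> Poly_Mapping.lookup a 0 = 0"
  by (induction rule: radial_ideal.induct)
     (simp_all add: lookup_times_0 lookup_add lookup_minus commutator_def)

lemma free_scalar_commute:
  "Poly_Mapping.single 0 c * f = f * Poly_Mapping.single 0 c" for f :: free_alg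
proof (induction f rule: update_induct)
  case (update f a b)
  then have "Poly_Mapping.update a b f = f + Poly_Mapping.single a b"
    by (intro poly_mapping_eqI)
       (auto simp: lookup_update lookup_add lookup_single when_def in_keys_iff)
  then show ?case
    using update by (simp add: distrib_left distrib_right mult_single mult.commute)
qed simp

quotient_type radial = "free_alg" / "\<lambda>a b. a - b \<in> radial_ideal"
proof (rule equivpI)
  show "reflp (\<lambda>a b. a - b \<in> radial_ideal)"
    by (simp add: reflp_def radial_ideal.zero)
  show "symp (\<lambda>a b. a - b \<in> radial_ideal)"
    using radial_ideal_uminus by (fastforce simp: symp_def)
  show "transp (\<lambda>a b. a - b \<in> radial_ideal)"
    using radial_ideal.add by (fastforce simp: transp_def)
qed

instantiation radial :: real_algebra_1
begin
lift_definition zero_radial :: radial is 0 .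
lift_definition one_radial :: radial is 1 .
lift_definition plus_radial :: "radial \<Rightarrow> radial \<Rightarrow> radial" is "(+)"
  using radial_ideal.add by (metis add_diff_add)
lift_definition minus_radial :: "radial \<Rightarrow> radial \<Rightarrow> radial" is "(-)"
proof -
  fix a a' b b' :: free_alg
  assume "a - a' \<in> radial_ideal" "b - b' \<in> radial_ideal"
  then have "(a - a') - (b - b') \<in> radial_ideal" by (rule radial_ideal_diff)
  then show "a - b - (a' - b') \<in> radial_ideal" by (simp add: algebra_simps)
qed
lift_definition uminus_radial :: "radial \<Rightarrow> radial" is uminus
  using radial_ideal_uminus by (metis minus_diff_minus)
lift_definition times_radial :: "radial \<Rightarrow> radial \<Rightarrow> radial" is "(*)"
proof -
  fix a a' b b' :: free_alg
  assume "a - a' \<in> radial_ideal" "b - b' \<in> radial_ideal"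
  then have "(a - a') * b + a' * (b - b') \<in> radial_ideal"
    by (intro radial_ideal.add radial_ideal_mult_left radial_ideal_mult_right)
  then show "a * b - a' * b' \<in> radial_ideal" by (simp add: algebra_simps)
qed
lift_definition scaleR_radial :: "real \<Rightarrow> radial \<Rightarrow> radial"
  is "\<lambda>c f. Poly_Mapping.single 0 c * f"
  using radial_ideal_mult_left by (metis right_diff_distrib)
instance
proof
  have eq: "a = b \<Longrightarrow> a - b \<in> radial_ideal" for a b by (simp add: radial_ideal.zero)
  fix a b c :: radial and x y :: real
  show "a + b + c = a + (b + c)" by transfer (simp add: radial_ideal.zero add.assoc)
  show "a + b = b + a" by transfer (simp add: radial_ideal.zero add.commute)
  show "0 + a = a" by transfer (simp add: radial_ideal.zero)
  show "- a + a = 0" by transfer (simp add: radial_ideal.zero)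
  show "a - b = a + - b" by transfer (simp add: radial_ideal.zero)
  show "a * b * c = a * (b * c)" by transfer (simp add: radial_ideal.zero mult.assoc)
  show "1 * a = a" by transfer (simp add: radial_ideal.zero)
  show "a * 1 = a" by transfer (simp add: radial_ideal.zero)
  show "(a + b) * c = a * c + b * c" by transfer (simp add: radial_ideal.zero distrib_right)
  show "a * (b + c) = a * b + a * c" by transfer (simp add: radial_ideal.zero distrib_left)
  show "(0 :: radial) \<noteq> 1"
    by transfer (use radial_ideal_lookup_0[of "0 - 1"] in \<open>auto simp: lookup_one\<close>)
  show "x *\<^sub>R (a + b) = x *\<^sub>R a + x *\<^sub>R b" by transfer (simp add: radial_ideal.zero distrib_left)
  show "(x + y) *\<^sub>R a = x *\<^sub>R a + y *\<^sub>R a"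
    by transfer (simp add: radial_ideal.zero single_add distrib_right)
  show "x *\<^sub>R y *\<^sub>R a = (x * y) *\<^sub>R a"
    by transfer (simp add: radial_ideal.zero mult_single flip: mult.assoc)
  show "1 *\<^sub>R a = a" by transfer (simp add: radial_ideal.zero)
  show "x *\<^sub>R a * b = x *\<^sub>R (a * b)" by transfer (simp add: radial_ideal.zero mult.assoc)
  show "a * x *\<^sub>R b = x *\<^sub>R (a * b)"
    by transfer (metis free_scalar_commute mult.assoc eq)
qed
end

lift_definition vx :: radial is "free_var VX" .
lift_definition vy :: radial is "free_var VY" .

definition vw :: radial where "vw = (1/2) *\<^sub>R (vx * vy - vy * vx)"

definition sr :: radial where "sr = vx\<^sup>2"
definition ss :: radial where "ss = anticommutator vx vy"
definition st :: radial where "st = vy\<^sup>2"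


section \<open>Scalar polynomials in r, s, t\<close>

text \<open>
  A polynomial in \<open>\<real>[r,s,t]\<close> is a nested polynomial: outermost variable \<open>r\<close>, then \<open>s\<close>,
  innermost \<open>t\<close>.
\<close>

type_synonym scal = "real poly poly poly"

definition heval :: "('b::zero \<Rightarrow> 'a::ring_1) \<Rightarrow> 'a \<Rightarrow> 'b poly \<Rightarrow> 'a"
  where "heval h z p = (\<Sum>i\<le>degree p. h (coeff p i) * z ^ i)"

definition teval :: "real poly \<Rightarrow> radial"
  where "teval = heval of_real st"

definition scal_eval :: "scal \<Rightarrow> radial"
  where "scal_eval = heval (heval teval ss) sr"

text \<open>The division in \<open>qdiff\<close> is exact: \<open>u\<^sup>n - (P u)\<^sup>n\<close> is divisible by \<open>(1 - P) u\<close> for \<open>n \<ge> 1\<close>.\<close>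

definition qshift :: "'a::comm_ring_1 \<Rightarrow> 'a poly \<Rightarrow> 'a poly"
  where "qshift P f = pcompose f [:0, P:]"

definition qdiff :: "'a::idom_divide \<Rightarrow> 'a poly \<Rightarrow> 'a poly"
  where "qdiff P f = (f - qshift P f) div [:0, 1 - P:]"

definition shift_r :: "real \<Rightarrow> scal \<Rightarrow> scal"
  where "shift_r P = qshift [:[:P:]:]"

definition qdiff_r :: "real \<Rightarrow> scal \<Rightarrow> scal"
  where "qdiff_r P = qdiff [:[:P:]:]"

definition qdiff_s :: "real \<Rightarrow> scal \<Rightarrow> scal"
  where "qdiff_s P = map_poly (qdiff [:P:])"


section \<open>The right q-vector derivative\<close>

definition qnum :: "real \<Rightarrow> int \<Rightarrow> real"
  where "qnum q n = (1 - q powi n) / (1 - q)"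

definition dsc :: "real \<Rightarrow> scal \<Rightarrow> radial"
  where "dsc q f = (1 + q) *\<^sub>R (vx * scal_eval (qdiff_r (q\<^sup>2) f))
                 + 2 *\<^sub>R (vy * scal_eval (shift_r (q\<^sup>2) (qdiff_s q f)))"

definition is_qderiv :: "real \<Rightarrow> int \<Rightarrow> (radial \<Rightarrow> radial) \<Rightarrow> bool" where
  "is_qderiv q M D \<longleftrightarrow> linear D \<and> (\<forall>f.
     D (scal_eval f) = dsc q f \<and>
     D (vy * scal_eval f) = vy * dsc q f \<and>
     D (vx * scal_eval f) = qnum q M *\<^sub>R scal_eval f + (q powi M) *\<^sub>R (vx * dsc q f) \<and>
     D (vw * scal_eval f) = - (qnum q (M - 1) *\<^sub>R (vy * scal_eval f))
                            + (q powi (M - 1)) *\<^sub>R (vw * dsc q f))"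

text \<open>
  Existence and uniqueness of this operator are the freeness of the radial algebra over
  \<open>\<real>[r,s,t]\<close> with basis \<open>1, y, x, w\<close>.
\<close>

definition qderiv :: "real \<Rightarrow> int \<Rightarrow> radial \<Rightarrow> radial"
  where "qderiv q M = (THE D. is_qderiv q M D)"


section \<open>Blocks as modules over the polynomials in t\<close>

definition tscale :: "real poly \<Rightarrow> radial \<Rightarrow> radial"
  where "tscale p F = teval p * F"

lemma heval_pCons:
  assumes "h 0 = 0"
  shows "heval h z (pCons a p) = h a + heval h z p * z"
proof (cases "p = 0")
  case True
  then show ?thesis using assms by (simp add: heval_def)
next
  case False
  then have "heval h z (pCons a p) = (\<Sum>i\<le>Suc (degree p). h (coeff (pCons a p) i) * z ^ i)"
    by (simp add: heval_def)
  also have "\<dots> = h a + (\<Sum>i\<le>degree p. h (coeff p i) * z ^ Suc i)"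
    by (subst sum.atMost_Suc_shift) simp
  also have "\<dots> = h a + heval h z p * z"
    by (simp add: heval_def sum_distrib_right mult.assoc power_commutes)
  finally show ?thesis .
qed

lemma teval_0: "teval 0 = 0"
  by (simp add: teval_def heval_def)

lemma teval_pCons: "teval (pCons a p) = of_real a + teval p * st"
  by (simp add: teval_def heval_pCons)

lemma teval_1: "teval 1 = 1"
  by (simp add: teval_def heval_def)

lemma teval_add: "teval (p + q) = teval p + teval q"
  by (induction p q rule: poly_induct2) (simp_all add: teval_0 teval_pCons algebra_simps)

lemma teval_smult: "teval (smult c p) = of_real c * teval p"
  by (induction p) (simp_all add: teval_0 teval_pCons algebra_simps flip: of_real_mult)

lemma teval_st_commute: "teval p * st = st * teval p"
proof (induction p)
  case (pCons a p)
  then show ?case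
    by (simp add: teval_pCons distrib_left distrib_right Real_Vector_Spaces.of_real_def)
       (metis mult.assoc)
qed (simp add: teval_0)

lemma teval_mult: "teval (p * q) = teval p * teval q"
proof (induction p)
  case (pCons a p)
  then show ?case
    by (simp add: teval_pCons teval_add teval_smult distrib_right mult.assoc)
       (metis mult.assoc teval_st_commute)
qed (simp add: teval_0)

interpretation Rt: module tscale
  by unfold_locales
     (simp_all add: tscale_def teval_add teval_mult teval_1 distrib_left distrib_right mult.assoc)

definition block :: "nat \<Rightarrow> radial set" where
  "block k = Rt.span
     ({sr ^ a * ss ^ b | a b. 2 * a + b = k} \<union>
      {vy * sr ^ a * ss ^ b | a b. 2 * a + b = k} \<union>
      {vx * sr ^ a * ss ^ b | a b. 1 + 2 * a + b = k} \<union>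
      {vw * sr ^ a * ss ^ b | a b. 1 + 2 * a + b = k})"

definition right_mult_x :: "radial \<Rightarrow> radial"
  where "right_mult_x F = F * vx"

definition Rt_direct_sum :: "radial set \<Rightarrow> radial set \<Rightarrow> radial set \<Rightarrow> bool" where
  "Rt_direct_sum U A B \<longleftrightarrow>
     Rt.subspace U \<and> Rt.subspace A \<and> Rt.subspace B \<and>
     U = {a + b | a b. a \<in> A \<and> b \<in> B} \<and> A \<inter> B = {0}"

end

theory Submission
  imports Defs "HOL-Library.Product_Plus"
begin

text \<open>
  Writing \<open>F = a + y b + x c + w d\<close>, the composition of the derivative with right multiplication
  by \<open>x\<close> maps the pair \<open>(b, c)\<close> to the \<open>(y, x)\<close>-components and the pair \<open>(a, d)\<close> to the
  \<open>(1, w)\<close>-components. On a block each of these two maps is block triangular with respect to the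
  exponent of \<open>r\<close>: the variable \<open>t\<close> occurs only off the diagonal, and the diagonal blocks have
  real determinants which are nonzero because \<open>0 < q < 1\<close> and \<open>M \<ge> 1\<close>. Hence the composition
  is bijective on every block over the polynomials in \<open>t\<close>, and this splits off the kernel.

  The required freeness of the radial algebra comes from its action on quadruples of scalar
  polynomials by the formulas that left multiplication by \<open>x\<close> and \<open>y\<close> must satisfy.
\<close>

section \<open>Action of the radial algebra on coordinates\<close>

text \<open>Coordinates are always listed in the order of the basis \<open>1, y, x, w\<close>.\<close>

type_synonym coords = "scal \<times> scal \<times> scal \<times> scal"

definition scal_of_real :: "real \<Rightarrow> scal"
  where "scal_of_real c = [:[:[:c:]:]:]"

definition r_scal :: scal where "r_scal = [:0, 1:]"
text \<open>Since x y = s/2 + w and y x = s/2 - w, the variable s enters the multiplication tables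
  only through its half.\<close>

definition half_s :: scal where "half_s = [:[:0, [:1/2:]:]:]"
definition t_scal :: scal where "t_scal = [:[:[:0, 1:]:]:]"

lemma scal_of_real_simps [simp]:
  "scal_of_real 0 = 0" "scal_of_real 1 = 1"
  by (simp_all add: scal_of_real_def one_pCons)

lemma scal_of_real_add: "scal_of_real (a + b) = scal_of_real a + scal_of_real b"
  and scal_of_real_mult: "scal_of_real (a * b) = scal_of_real a * scal_of_real b"
  by (simp_all add: scal_of_real_def)

fun cscale :: "scal \<Rightarrow> coords \<Rightarrow> coords"
  where "cscale f (a, b, c, d) = (f * a, f * b, f * c, f * d)"

lemma cscale_simps:
  "cscale f (v + w) = cscale f v + cscale f w"
  "cscale (f + g) v = cscale f v + cscale g v"
  "cscale (f * g) v = cscale f (cscale g v)"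
  "cscale 0 v = 0" "cscale 1 v = v" "cscale f 0 = 0"
  by (cases v; cases w; simp add: zero_prod_def algebra_simps)+

lemma cscale_commute: "cscale f (cscale g v) = cscale g (cscale f v)"
  by (metis cscale_simps(3) mult.commute)

text \<open>Encodes x y = s/2 + w, x x = r and x w = r y - (s/2) x.\<close>

fun left_x :: "coords \<Rightarrow> coords"
  where "left_x (a, b, c, d) = (half_s * b + r_scal * c, r_scal * d, a - half_s * d, b)"

text \<open>Encodes y y = t, y x = s/2 - w and y w = (s/2) y - t x.\<close>

fun left_y :: "coords \<Rightarrow> coords"
  where "left_y (a, b, c, d) = (t_scal * b + half_s * c, a + half_s * d, - (t_scal * d), - c)"

text \<open>The columns come from w anticommuting with x and y, and from w^2 = s^2/4 - r t.\<close>

fun left_w :: "coords \<Rightarrow> coords"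
  where "left_w (a, b, c, d) =
    ((half_s * half_s - r_scal * t_scal) * d, - (half_s * b) - r_scal * c, t_scal * b + half_s * c, a)"

lemma left_x_linear:
  "left_x (v + w) = left_x v + left_x w" "left_x (cscale f v) = cscale f (left_x v)"
  and left_y_linear:
  "left_y (v + w) = left_y v + left_y w" "left_y (cscale f v) = cscale f (left_y v)"
  by (cases v; cases w; simp add: algebra_simps)+

text \<open>These are the cases behind the relations of the radial algebra: every anticommutator of
  generators acts as a scalar, and scalars commute with the action of the generators.\<close>

lemma left_x_squared: "left_x (left_x v) = cscale r_scal v"
  and left_y_squared: "left_y (left_y v) = cscale t_scal v"
  and left_xy_anticommutator:
    "left_x (left_y v) + left_y (left_x v) = cscale (half_s + half_s) v"
  by (cases v; simp add: algebra_simps)+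

lemma left_xy_commutator:
  "left_x (left_y v) - left_y (left_x v) = left_w v + left_w v"
  by (cases v; simp add: algebra_simps)

fun left_var :: "vvar \<Rightarrow> coords \<Rightarrow> coords"
  where "left_var VX = left_x" | "left_var VY = left_y"

lemma left_var_linear:
  "left_var u (v + w) = left_var u v + left_var u w"
  "left_var u (cscale f v) = cscale f (left_var u v)"
  by (cases u; simp add: left_x_linear left_y_linear)+

lemma left_var_0 [simp]: "left_var u 0 = 0"
  using left_var_linear(2)[of u 0 0] by (simp add: cscale_simps)

section \<open>Action of words and of the free algebra\<close>

definition left_word :: "vword \<Rightarrow> coords \<Rightarrow> coords"
  where "left_word w = foldr left_var (letters w)"

lemma left_word_add: "left_word (v + w) u = left_word v (left_word w u)"
  by (simp add: left_word_def plus_vword_def)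

lemma left_word_linear:
  "left_word u (v + w) = left_word u v + left_word u w"
  "left_word u (cscale f v) = cscale f (left_word u v)"
proof -
  have "foldr left_var us (v + w) = foldr left_var us v + foldr left_var us w"
    "foldr left_var us (cscale f v) = cscale f (foldr left_var us v)" for us
    by (induction us) (simp_all add: left_var_linear)
  then show "left_word u (v + w) = left_word u v + left_word u w"
    "left_word u (cscale f v) = cscale f (left_word u v)"
    by (simp_all add: left_word_def)
qed

lemma left_word_0 [simp]: "left_word u 0 = 0"
  using left_word_linear(2)[of u 0 0] by (simp add: cscale_simps)

definition free_act :: "free_alg \<Rightarrow> coords \<Rightarrow> coords"
  where "free_act f v =
    Sum_any (\<lambda>w. cscale (scal_of_real (Poly_Mapping.lookup f w)) (left_word w v))"

lemma free_act_single:
  "free_act (Poly_Mapping.single w c) v = cscale (scal_of_real c) (left_word w v)"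
proof -
  have "(\<lambda>u. cscale (scal_of_real (Poly_Mapping.lookup (Poly_Mapping.single w c) u)) (left_word u v))
      = (\<lambda>u. cscale (scal_of_real c) (left_word w v) when u = w)"
    by (auto simp: lookup_single when_def cscale_simps)
  then show ?thesis unfolding free_act_def by (simp only: Sum_any_when_equal)
qed

lemma free_act_add: "free_act (f + g) v = free_act f v + free_act g v"
proof -
  have fin: "finite {w. cscale (scal_of_real (Poly_Mapping.lookup h w)) (left_word w v) \<noteq> 0}"
    for h :: free_alg
    by (rule finite_subset[OF _ finite_lookup[of h]]) (auto simp: cscale_simps)
  show ?thesis
    unfolding free_act_def
    by (simp add: lookup_add scal_of_real_add cscale_simps Sum_any.distrib[OF fin fin])
qed

lemma free_act_0: "free_act 0 v = 0"
  by (simp add: free_act_def cscale_simps)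

lemma free_alg_induct [case_names zero single add]:
  fixes f :: free_alg
  assumes "P 0" "\<And>w c. P (Poly_Mapping.single w c)" "\<And>f g. P f \<Longrightarrow> P g \<Longrightarrow> P (f + g)"
  shows "P f"
proof (induction f rule: update_induct)
  case (update f a b)
  then have "Poly_Mapping.update a b f = f + Poly_Mapping.single a b"
    by (intro poly_mapping_eqI)
       (auto simp: lookup_update lookup_add lookup_single when_def in_keys_iff)
  then show ?case using assms update by simp
qed (rule assms)

lemma free_act_linear:
  "free_act f (v + w) = free_act f v + free_act f w"
  "free_act f (cscale g v) = cscale g (free_act f v)"
  by (induction f rule: free_alg_induct)
     (simp_all add: free_act_0 free_act_single free_act_add cscale_simps left_word_linear
       cscale_commute algebra_simps)

lemma free_act_mult: "free_act (f * g) v = free_act f (free_act g v)"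
proof (induction f rule: free_alg_induct)
  case (single w c)
  show ?case
    by (induction g rule: free_alg_induct)
       (simp_all add: free_act_0 free_act_single free_act_add mult_single left_word_linear
         left_word_add distrib_left cscale_simps scal_of_real_mult cscale_commute)
qed (simp_all add: free_act_0 free_act_add distrib_right)

lemma free_act_var: "free_act (free_var u) v = left_var u v"
  by (simp add: free_var_def free_act_single left_word_def cscale_simps)

lemma free_act_diff: "free_act (f - g) v = free_act f v - free_act g v"
  using free_act_add[of "f - g" g v] by simp

text \<open>The anticommutator of two generators acts as multiplication by 2 r, s or 2 t. Such a
  multiplication commutes with the third generator, so each generator of the ideal acts as zero and
  the action descends to the quotient.\<close>

lemma free_act_radial_ideal: "f \<in> radial_ideal \<Longrightarrow> free_act f v = 0"
proof (induction arbitrary: v rule: radial_ideal.induct)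
  case (gen a u1 u2 u3 b)
  have "\<exists>f. \<forall>v. left_var u1 (left_var u2 v) + left_var u2 (left_var u1 v) = cscale f v"
    by (cases u1; cases u2)
       (auto simp: left_x_squared left_y_squared left_xy_anticommutator add.commute
          simp flip: cscale_simps(2))
  then obtain f where f:
    "\<And>v. left_var u1 (left_var u2 v) + left_var u2 (left_var u1 v) = cscale f v"
    by blast
  show ?case
    by (simp add: free_act_mult free_act_diff commutator_def anticommutator_def free_act_add
          free_act_var f left_var_linear free_act_linear(2)[of a 0 0, unfolded cscale_simps])
qed (simp_all add: free_act_0 free_act_add)

lift_definition act :: "radial \<Rightarrow> coords \<Rightarrow> coords" is free_act
proof
  fix f g :: free_alg and v
  assume "f - g \<in> radial_ideal"
  from free_act_radial_ideal[OF this, of v] show "free_act f v = free_act g v"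
    by (simp add: free_act_diff)
qed

lemma act_add: "act (F + G) v = act F v + act G v"
  and act_diff: "act (F - G) v = act F v - act G v"
  and act_mult: "act (F * G) v = act F (act G v)"
  and act_scaleR: "act (c *\<^sub>R F) v = cscale (scal_of_real c) (act F v)"
  and act_1: "act 1 v = v"
  and act_vx: "act vx v = left_x v"
  and act_vy: "act vy v = left_y v"
  by (transfer; simp add: free_act_add free_act_diff free_act_mult free_act_single free_act_var
        left_word_def zero_vword_def cscale_simps flip: single_one)+

lemma act_0: "act 0 v = 0"
  by transfer (simp add: free_act_0)

lemma cscale_half: "cscale (scal_of_real (1/2)) (v + v) = v"
proof -
  have "cscale (scal_of_real (1/2)) (v + v)
      = cscale (scal_of_real (1/2) + scal_of_real (1/2)) v"
    by (simp only: cscale_simps)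
  then show ?thesis
    by (simp add: cscale_simps flip: scal_of_real_add)
qed

lemma act_vw: "act vw v = left_w v"
  by (simp add: vw_def act_scaleR act_diff act_mult act_vx act_vy left_xy_commutator cscale_half
       del: left_x.simps left_y.simps left_w.simps)

lemma act_sr: "act sr v = cscale [:0, 1:] v"
  and act_ss: "act ss v = cscale [:[:0, 1:]:] v"
  and act_st: "act st v = cscale [:[:[:0, 1:]:]:] v"
proof -
  have "half_s + half_s = [:[:0, 1:]:]" by (simp add: half_s_def one_pCons)
  then show "act ss v = cscale [:[:0, 1:]:] v"
    by (simp add: ss_def anticommutator_def act_add act_mult act_vx act_vy left_xy_anticommutator)
  show "act sr v = cscale [:0, 1:] v" "act st v = cscale [:[:[:0, 1:]:]:] v"
    by (simp_all add: sr_def st_def power2_eq_square act_mult act_vx act_vy left_x_squared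
          left_y_squared r_scal_def t_scal_def)
qed

lemma act_teval: "act (teval p) v = cscale [:[:p:]:] v"
proof (induction p arbitrary: v)
  case (pCons a p)
  have "act (of_real a) v = cscale (scal_of_real a) v"
    by (simp add: Real_Vector_Spaces.of_real_def act_scaleR act_1)
  moreover have "[:[:pCons a p:]:] = scal_of_real a + [:[:p:]:] * [:[:[:0, 1:]:]:]"
    by (simp add: scal_of_real_def)
  ultimately show ?case
    by (simp only: teval_pCons act_add act_mult pCons.IH act_st cscale_simps)
qed (simp add: teval_0 act_0 cscale_simps)

lemma act_heval_teval: "act (heval teval ss p) v = cscale [:p:] v"
proof (induction p arbitrary: v)
  case (pCons a p)
  have "[:pCons a p:] = [:[:a:]:] + [:p:] * [:[:0, 1:]:]"
    by simp
  then show ?case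
    by (simp only: heval_pCons[of teval, OF teval_0] act_add act_mult pCons.IH act_teval act_ss
        cscale_simps)
qed (simp add: heval_def teval_0 act_0 cscale_simps)

text \<open>This yields the algebraic independence of r, s, t: a polynomial is recovered by letting
  its value act on the coordinates of 1.\<close>

lemma act_scal_eval: "act (scal_eval f) v = cscale f v"
proof -
  have 0: "heval teval ss 0 = 0" by (simp add: heval_def teval_0)
  show ?thesis
  proof (induction f arbitrary: v)
    case (pCons a p)
    have "act (scal_eval (pCons a p)) v = cscale [:a:] v + cscale p (cscale [:0, 1:] v)"
      by (simp only: scal_eval_def heval_pCons[of "heval teval ss", OF 0] act_add act_mult
          pCons.IH[unfolded scal_eval_def] act_heval_teval act_sr)
    also have "\<dots> = cscale ([:a:] + p * [:0, 1:]) v"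
      by (simp only: cscale_simps)
    finally show ?case by simp
  qed (simp add: scal_eval_def heval_def teval_0 act_0 cscale_simps)
qed

section \<open>Freeness over the scalar polynomials\<close>

lemma heval_add:
  assumes "h 0 = 0" "\<And>a b. h (a + b) = h a + h b"
  shows "heval h z (p + q) = heval h z p + heval h z q"
  by (induction p q rule: poly_induct2)
     (simp_all add: heval_pCons assms heval_def[of _ _ 0] algebra_simps)

lemma heval_commute:
  assumes "h 0 = 0" "\<And>a. g * h a = h a * g" "g * z = z * g"
  shows "g * heval h z p = heval h z p * g"
proof (induction p)
  case (pCons a p)
  have "g * (heval h z p * z) = heval h z p * z * g"
    by (metis pCons.IH assms(3) mult.assoc)
  then show ?case
    by (simp add: heval_pCons assms algebra_simps)
qed (simp add: heval_def assms)

text \<open>The target is not commutative, so the induction has to move the evaluation point past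
  the image of each coefficient.\<close>

lemma heval_mult:
  assumes h: "h 0 = 0" "\<And>a b. h (a + b) = h a + h b" "\<And>a b. h (a * b) = h a * h b"
    and z: "\<And>a. z * h a = h a * z"
  shows "heval h z (p * q) = heval h z p * heval h z q"
proof (induction p)
  case (pCons a p)
  have zq: "z * heval h z q = heval h z q * z" for q
    by (rule heval_commute) (simp_all add: h z)
  have sm: "heval h z (smult a q) = h a * heval h z q" for q
    by (induction q) (simp_all add: heval_pCons h heval_def[of _ _ 0] distrib_left mult.assoc)
  show ?case
    by (simp add: heval_pCons heval_add sm h pCons.IH distrib_right)
       (metis mult.assoc zq)
qed (simp add: heval_def h)

lemma radial_relation:
  "anticommutator vx vx * vy = vy * anticommutator vx vx"
  "anticommutator vx vy * vx = vx * anticommutator vx vy"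
  "anticommutator vx vy * vy = vy * anticommutator vx vy"
  "anticommutator vy vy * vx = vx * anticommutator vy vy"
  unfolding anticommutator_def
  by (transfer;
      use radial_ideal.gen[of 1 _ _ _ 1] in \<open>simp add: anticommutator_def commutator_def\<close>)+

text \<open>Removes the factor 2 in {x,x} = 2 x^2, so that the defining relations give centrality of
  x^2 itself.\<close>

lemma double_eqD: "a + a = b + b \<Longrightarrow> a = b" for a b :: "'a::real_vector"
  by (metis scaleR_half_double)

lemma central_sr: "vx * sr = sr * vx" "vy * sr = sr * vy"
  and central_ss: "vx * ss = ss * vx" "vy * ss = ss * vy"
  and central_st: "vx * st = st * vx" "vy * st = st * vy"
proof -
  show "vy * sr = sr * vy"
    using radial_relation(1)
    by - (rule double_eqD, simp add: sr_def anticommutator_def power2_eq_square algebra_simps)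
  show "vx * st = st * vx"
    using radial_relation(4)
    by - (rule double_eqD, simp add: st_def anticommutator_def power2_eq_square algebra_simps)
qed (simp_all add: sr_def st_def ss_def radial_relation power2_eq_square mult.assoc)

lemma of_real_commute: "F * of_real c = of_real c * (F :: 'a::real_algebra_1)"
  by (simp add: Real_Vector_Spaces.of_real_def)

lemma scal_eval_commute:
  assumes "F * sr = sr * F" "F * ss = ss * F" "F * st = st * F"
  shows "F * scal_eval f = scal_eval f * F"
  unfolding scal_eval_def teval_def
  by (intro heval_commute assms of_real_commute) (simp_all add: heval_def)

lemma scal_eval_commute_vars:
  "vx * scal_eval f = scal_eval f * vx" "vy * scal_eval f = scal_eval f * vy"
  by (simp_all add: scal_eval_commute central_sr central_ss central_st)

lemma scal_eval_0: "scal_eval 0 = 0"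
  by (simp add: scal_eval_def heval_def teval_0)

lemma teval_heval_0: "heval teval ss 0 = 0"
  by (simp add: heval_def teval_0)

lemma heval_teval_add: "heval teval ss (p + q) = heval teval ss p + heval teval ss q"
  by (simp add: heval_add teval_0 teval_add)

lemma commute_ss: "ss * st = st * ss" and commute_sr: "sr * st = st * sr" "sr * ss = ss * sr"
proof -
  show "sr * ss = ss * sr" "sr * st = st * sr"
    unfolding sr_def by (simp_all add: power2_eq_square) (metis mult.assoc central_ss central_st)+
  have "vx * vy * st = st * (vx * vy)" "vy * vx * st = st * (vy * vx)"
    by (metis mult.assoc central_st)+
  then show "ss * st = st * ss"
    unfolding ss_def anticommutator_def by (simp add: algebra_simps)
qed

lemma teval_commute: "F * st = st * F \<Longrightarrow> F * teval p = teval p * F"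
  unfolding teval_def by (intro heval_commute of_real_commute) simp_all

lemma heval_teval_mult: "heval teval ss (p * q) = heval teval ss p * heval teval ss q"
  by (intro heval_mult teval_0 teval_add teval_mult teval_commute commute_ss)

lemma scal_eval_add: "scal_eval (f + g) = scal_eval f + scal_eval g"
  unfolding scal_eval_def by (intro heval_add teval_heval_0 heval_teval_add)

lemma scal_eval_mult: "scal_eval (f * g) = scal_eval f * scal_eval g"
  unfolding scal_eval_def
  by (intro heval_mult heval_commute teval_commute teval_heval_0 teval_0 heval_teval_add
      heval_teval_mult commute_sr)

lemma scal_eval_minus: "scal_eval (- f) = - scal_eval f"
  using scal_eval_add[of "- f" f] by (simp add: scal_eval_0 eq_neg_iff_add_eq_0)

lemma scal_eval_diff: "scal_eval (f - g) = scal_eval f - scal_eval g"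
  using scal_eval_add[of f "- g"] by (simp add: scal_eval_minus)

lemma scal_eval_teval: "scal_eval [:[:p:]:] = teval p"
  by (simp add: scal_eval_def heval_def)

lemma scal_eval_of_real: "scal_eval (scal_of_real c) = of_real c"
  unfolding scal_of_real_def scal_eval_teval by (simp add: teval_def heval_def)

lemma scal_eval_1: "scal_eval 1 = 1"
  using scal_eval_of_real[of 1] by simp

lemma scal_eval_r: "scal_eval r_scal = sr"
  by (simp add: r_scal_def scal_eval_def heval_pCons teval_heval_0)
     (simp add: heval_def teval_0 teval_1)

lemma scal_eval_half_s: "scal_eval half_s = (1/2) *\<^sub>R ss"
  by (simp add: half_s_def scal_eval_def heval_pCons teval_heval_0 teval_0)
     (simp add: heval_def teval_pCons teval_0 Real_Vector_Spaces.of_real_def)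

lemma scal_eval_t: "scal_eval t_scal = st"
  by (simp add: t_scal_def scal_eval_teval teval_pCons teval_0)

section \<open>The coordinate isomorphism\<close>

fun emb :: "coords \<Rightarrow> radial"
  where "emb (a, b, c, d) = scal_eval a + vy * scal_eval b + vx * scal_eval c + vw * scal_eval d"

text \<open>Since F = F 1, the coordinates of F are obtained by letting F act on those of 1.\<close>

definition coords :: "radial \<Rightarrow> coords"
  where "coords F = act F (1, 0, 0, 0)"

text \<open>The left inverse expresses linear independence of 1, y, x, w over the scalar
  polynomials.\<close>

lemma coords_emb: "coords (emb v) = v"
  by (cases v) (simp add: coords_def act_add act_mult act_scal_eval act_vx act_vy act_vw)

lemma emb_add: "emb (v + w) = emb v + emb w"
  by (cases v; cases w) (simp add: scal_eval_add algebra_simps)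

lemma scal_eval_central: "F * scal_eval f = scal_eval f * F" if "F \<in> {vx, vy, vw}"
proof -
  have "vx * (vy * scal_eval f) = scal_eval f * (vx * vy)"
    "vy * (vx * scal_eval f) = scal_eval f * (vy * vx)"
    by (metis mult.assoc scal_eval_commute_vars)+
  then have "vw * scal_eval f = scal_eval f * vw"
    by (simp add: vw_def algebra_simps)
  then show ?thesis using that scal_eval_commute_vars by blast
qed

lemma emb_cscale: "emb (cscale f v) = scal_eval f * emb v"
proof (cases v)
  case (fields a b c d)
  have *: "F * (scal_eval f * G) = scal_eval f * (F * G)" if "F \<in> {vx, vy, vw}" for F G
    using scal_eval_central[OF that] by (metis mult.assoc)
  then show ?thesis
    by (simp add: fields scal_eval_mult distrib_left *)
qed

lemma emb_scaleR: "c *\<^sub>R emb v = emb (cscale (scal_of_real c) v)"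
  by (simp add: emb_cscale scal_eval_of_real scaleR_conv_of_real)

lemma emb_tscale: "tscale p (emb v) = emb (cscale [:[:p:]:] v)"
  by (simp add: emb_cscale scal_eval_teval tscale_def)

lemma radial_products:
  "vx * vx = sr" "vy * vy = st" "vx * vy = (1/2) *\<^sub>R ss + vw" "vy * vx = (1/2) *\<^sub>R ss - vw"
  "vx * vw = sr * vy - (1/2) *\<^sub>R ss * vx" "vy * vw = (1/2) *\<^sub>R ss * vy - st * vx"
proof -
  have half: "(1/2) *\<^sub>R a + (1/2) *\<^sub>R a = a" for a :: radial
    by (simp flip: scaleR_left_distrib)
  show xx: "vx * vx = sr" and yy: "vy * vy = st"
    by (simp_all add: sr_def st_def power2_eq_square)
  show xy: "vx * vy = (1/2) *\<^sub>R ss + vw" and yx: "vy * vx = (1/2) *\<^sub>R ss - vw"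
    by (simp_all add: ss_def vw_def anticommutator_def algebra_simps half)
  \<comment> \<open>Of the two expressions x y - s/2 and s/2 - y x for w, the one is taken that puts
    equal generators next to each other.\<close>
  have "vx * vw = vx * (vx * vy - (1/2) *\<^sub>R ss)" "vy * vw = vy * ((1/2) *\<^sub>R ss - vy * vx)"
    by (simp_all add: xy yx)
  then show "vx * vw = sr * vy - (1/2) *\<^sub>R ss * vx" "vy * vw = (1/2) *\<^sub>R ss * vy - st * vx"
    by (simp_all add: right_diff_distrib central_ss xx yy flip: mult.assoc)
qed

lemma vx_emb: "vx * emb v = emb (left_x v)"
proof (cases v)
  case (fields a b c d)
  have "vx * emb v = vx * scal_eval a + vx * vy * scal_eval b + vx * vx * scal_eval c
      + vx * vw * scal_eval d"
    by (simp add: fields algebra_simps)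
  also have "\<dots> = emb (left_x v)"
    using central_sr central_ss
    by (simp add: fields radial_products scal_eval_mult scal_eval_add scal_eval_diff scal_eval_r
        scal_eval_half_s distrib_left distrib_right left_diff_distrib right_diff_distrib
        flip: mult.assoc)
  finally show ?thesis .
qed

lemma vy_emb: "vy * emb v = emb (left_y v)"
proof (cases v)
  case (fields a b c d)
  have "vy * emb v = vy * scal_eval a + vy * vy * scal_eval b + vy * vx * scal_eval c
      + vy * vw * scal_eval d"
    by (simp add: fields algebra_simps)
  also have "\<dots> = emb (left_y v)"
    using central_st central_ss
    by (simp add: fields radial_products scal_eval_mult scal_eval_add scal_eval_diff scal_eval_t
        scal_eval_half_s scal_eval_minus distrib_left distrib_right left_diff_distrib
        right_diff_distrib flip: mult.assoc)
  finally show ?thesis .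
qed

text \<open>The algebra is spanned by words, and a word is built by left multiplication with its
  letters.\<close>

lemma radial_induct [case_names one add scaleR vx vy]:
  assumes one: "P 1" and add: "\<And>F G. P F \<Longrightarrow> P G \<Longrightarrow> P (F + G)"
    and scaleR: "\<And>c F. P F \<Longrightarrow> P (c *\<^sub>R F)"
    and vx: "\<And>F. P F \<Longrightarrow> P (vx * F)" and vy: "\<And>F. P F \<Longrightarrow> P (vy * F)"
  shows "P F"
proof -
  have "P (abs_radial f)" for f
  proof (induction f rule: free_alg_induct)
    case zero
    have "P (0 *\<^sub>R 1)" by (intro scaleR one)
    then show ?case by (simp add: zero_radial_def)
  next
    case (single w c)
    have word: "P (abs_radial (Poly_Mapping.single (VWord us) 1))" for us
    proof (induction us)
      case Nil
      then show ?case using one by (simp add: one_radial_def zero_vword_def flip: single_one)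
    next
      case (Cons u us)
      have "abs_radial (Poly_Mapping.single (VWord (u # us)) 1)
          = abs_radial (free_var u) * abs_radial (Poly_Mapping.single (VWord us) 1)"
        by (simp add: times_radial.abs_eq free_var_def mult_single plus_vword_def)
      then show ?case using Cons vx vy by (cases u) (simp_all add: vx_def vy_def)
    qed
    have "abs_radial (Poly_Mapping.single w c)
        = c *\<^sub>R abs_radial (Poly_Mapping.single (VWord (letters w)) 1)"
      by (simp add: scaleR_radial.abs_eq mult_single)
    then show ?case by (metis word scaleR)
  next
    case (add f g)
    then show ?case using assms(2) by (simp add: plus_radial.abs_eq[symmetric])
  qed
  then show ?thesis by (induction F rule: radial.abs_induct) simp
qed

text \<open>The range of \<open>emb\<close> contains 1 and is closed under sums, real multiples and
  left multiplication by x and y, so it is everything. Together with \<open>coords_emb\<close> this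
  is the freeness of the radial algebra.\<close>

lemma emb_coords: "emb (coords F) = F"
proof -
  have "\<exists>v. F = emb v"
  proof (induction F rule: radial_induct)
    case one
    have "1 = emb (1, 0, 0, 0)" by (simp add: scal_eval_0 scal_eval_1)
    then show ?case by blast
  qed (metis emb_add emb_scaleR vx_emb vy_emb)+
  then show ?thesis using coords_emb by auto
qed

lemma coords_eqI: "coords F = coords G \<Longrightarrow> F = G"
  by (metis emb_coords)

lemma coords_mult: "coords (F * G) = act F (coords G)"
  by (simp add: coords_def act_mult)

text \<open>Encodes y x = s/2 - w, x x = r and w x = (s/2) x - r y.\<close>

fun right_x :: "coords \<Rightarrow> coords"
  where "right_x (a, b, c, d) =
    (half_s * b + r_scal * c, - (r_scal * d), a + half_s * d, - b)"

text \<open>The left action suffices: the coordinates of F x arise by letting F act on the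
  coordinates of x.\<close>

lemma right_mult_x_emb: "right_mult_x (emb v) = emb (right_x v)"
proof (rule coords_eqI)
  have "coords vx = (0, 0, 1, 0)"
    by (simp add: coords_def act_vx)
  then show "coords (right_mult_x (emb v)) = coords (emb (right_x v))"
    unfolding right_mult_x_def coords_mult coords_emb
    by (cases v) (simp add: act_add act_mult act_scal_eval act_vx
        act_vy act_vw algebra_simps)
qed

section \<open>The derivative in coordinates\<close>

abbreviation rs_coeff :: "scal \<Rightarrow> nat \<Rightarrow> nat \<Rightarrow> real poly"
  where "rs_coeff f i j \<equiv> coeff (coeff f i) j"

lemma scal_eqI: "(\<And>i j. rs_coeff f i j = rs_coeff g i j) \<Longrightarrow> f = g"
  by (rule poly_eqI, rule poly_eqI) simp

lemma rs_coeff_mult: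
  "rs_coeff (scal_of_real e * f) i j = smult e (rs_coeff f i j)"
  "rs_coeff ([:[:p:]:] * f) i j = p * rs_coeff f i j"
  "rs_coeff (t_scal * f) i j = [:0, 1:] * rs_coeff f i j"
  "rs_coeff (half_s * f) i j = (case j of 0 \<Rightarrow> 0 | Suc j' \<Rightarrow> smult (1/2) (rs_coeff f i j'))"
  "rs_coeff (r_scal * f) i j = (case i of 0 \<Rightarrow> 0 | Suc i' \<Rightarrow> rs_coeff f i' j)"
  by (simp_all add: scal_of_real_def t_scal_def half_s_def r_scal_def coeff_pCons split: nat.splits)

text \<open>The factor is the P-analogue of n + 1. It is kept as a geometric sum because P is a
  constant polynomial in the applications, where a quotient by 1 - P is awkward.\<close>

lemma coeff_qdiff:
  fixes P :: "'a::idom_divide"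
  assumes "P \<noteq> 1"
  shows "coeff (qdiff P f) n = (\<Sum>j\<le>n. P ^ j) * coeff f (Suc n)"
proof -
  \<comment> \<open>The quotient is given by its coefficients in advance, so exactness of the
    division becomes a check of a product.\<close>
  define g where "g = (\<Sum>m\<le>degree f. monom ((\<Sum>j\<le>m. P ^ j) * coeff f (Suc m)) m)"
  have g: "coeff g n = (\<Sum>j\<le>n. P ^ j) * coeff f (Suc n)" for n
    by (simp add: g_def coeff_sum coeff_eq_0)
  have "f - qshift P f = g * [:0, 1 - P:]"
  proof (rule poly_eqI)
    fix n
    show "coeff (f - qshift P f) n = coeff (g * [:0, 1 - P:]) n"
    proof (cases n)
      case (Suc m)
      have "1 - P ^ Suc m = (1 - P) * (\<Sum>j\<le>m. P ^ j)"
        by (rule sum_gp_basic[symmetric])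
      then have "(1 - P ^ Suc m) * coeff f (Suc m) = (1 - P) * coeff g m"
        by (simp only: g mult.assoc)
      then show ?thesis
        by (simp add: Suc qshift_def coeff_pcompose_linear algebra_simps)
    qed (simp add: qshift_def coeff_pcompose_linear poly_0_coeff_0)
  qed
  then have "qdiff P f = g"
    using assms by (simp add: qdiff_def del: mult_pCons_right)
  then show ?thesis by (simp add: g)
qed

lemma const_power_sum: "(\<Sum>j\<le>n. [:P:] ^ j) = [:\<Sum>j\<le>n. P ^ j:]" for P :: "'a::comm_ring_1"
  by (induction n) (simp_all add: poly_const_pow one_pCons)

lemma rs_coeff_qdiff_r:
  "P \<noteq> 1 \<Longrightarrow> rs_coeff (qdiff_r P f) i j = smult (\<Sum>l\<le>i. P ^ l) (rs_coeff f (Suc i) j)"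
  by (simp add: qdiff_r_def coeff_qdiff const_power_sum one_pCons)

lemma rs_coeff_shift_r: "rs_coeff (shift_r P f) i j = smult (P ^ i) (rs_coeff f i j)"
  by (simp add: shift_r_def qshift_def coeff_pcompose_linear poly_const_pow)

lemma rs_coeff_qdiff_s:
  assumes "P \<noteq> 1"
  shows "rs_coeff (qdiff_s P f) i j = smult (\<Sum>l\<le>j. P ^ l) (rs_coeff f i (Suc j))"
proof -
  have "qdiff [:P:] 0 = 0" by (simp add: qdiff_def qshift_def)
  then show ?thesis
    using assms by (simp add: qdiff_s_def coeff_map_poly coeff_qdiff const_power_sum one_pCons)
qed

definition qnat :: "real \<Rightarrow> nat \<Rightarrow> real"
  where "qnat q n = (1 - q ^ n) / (1 - q)"

lemma qnat_sum: "q \<noteq> 1 \<Longrightarrow> (\<Sum>l\<le>n. q ^ l) = qnat q (Suc n)"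
  using sum_gp_basic[of q n] by (simp add: qnat_def field_simps)

text \<open>The factorization 1 - q^2 = (1 + q)(1 - q) turns the q^2-number of n + 1 into the
  q-number of 2 n + 2. It absorbs the factor 1 + q in \<open>dsc\<close>.\<close>

lemma qnat_sum_squares:
  assumes "0 < q" "q < 1"
  shows "(1 + q) * (\<Sum>l\<le>n. (q\<^sup>2) ^ l) = qnat q (2 * n + 2)"
proof -
  have "(1 - q\<^sup>2) * (\<Sum>l\<le>n. (q\<^sup>2) ^ l) = 1 - q ^ (2 * n + 2)"
    using sum_gp_basic[of "q\<^sup>2" n] power_mult[of q 2 "Suc n"] by simp
  moreover have "(1 - q\<^sup>2) * S = (1 + q) * S * (1 - q)" for S
    by (simp add: power2_eq_square algebra_simps)
  ultimately have "(1 + q) * (\<Sum>l\<le>n. (q\<^sup>2) ^ l) * (1 - q) = 1 - q ^ (2 * n + 2)"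
    by metis
  then show ?thesis
    unfolding qnat_def using assms by (intro eq_divide_imp) simp_all
qed

lemma qnat_0 [simp]: "qnat q 0 = 0"
  by (simp add: qnat_def)

lemma qnat_nonneg: "0 < q \<Longrightarrow> q < 1 \<Longrightarrow> 0 \<le> qnat q n"
  by (simp add: qnat_def power_le_one)

lemma qnat_pos: "0 < q \<Longrightarrow> q < 1 \<Longrightarrow> 0 < n \<Longrightarrow> 0 < qnat q n"
  using power_strict_decreasing[of 0 n q] by (simp add: qnat_def)

lemma qnat_add: "q < 1 \<Longrightarrow> qnat q (m + n) = qnat q m + q ^ m * qnat q n"
  by (simp add: qnat_def field_simps power_add)

text \<open>\<open>grad_r\<close> and \<open>grad_s\<close> are the x- and the y-coordinate of
  \<open>dsc\<close>.\<close>

definition grad_r :: "real \<Rightarrow> scal \<Rightarrow> scal"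
  where "grad_r q f = scal_of_real (1 + q) * qdiff_r (q\<^sup>2) f"

definition grad_s :: "real \<Rightarrow> scal \<Rightarrow> scal"
  where "grad_s q f = scal_of_real 2 * shift_r (q\<^sup>2) (qdiff_s q f)"

text \<open>The parameter \<open>Q\<close> stands for \<open>q\<^sup>M\<^sup>-\<^sup>1\<close>, not for the \<open>q\<^sup>M\<close> of the informal statement.\<close>

fun deriv_coords :: "real \<Rightarrow> real \<Rightarrow> coords \<Rightarrow> coords"
  where "deriv_coords q Q (a, b, c, d) =
    (half_s * grad_r q b + t_scal * grad_s q b + scal_of_real ((1 - q * Q) / (1 - q)) * c
       + scal_of_real (q * Q) * (r_scal * grad_r q c + half_s * grad_s q c),
     grad_s q a - scal_of_real ((1 - Q) / (1 - q)) * d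
       - scal_of_real Q * (r_scal * grad_r q d + half_s * grad_s q d),
     grad_r q a + scal_of_real Q * (t_scal * grad_s q d + half_s * grad_r q d),
     scal_of_real (q * Q) * grad_s q c - grad_r q b)"

context
  fixes q :: real
  assumes q: "0 < q" "q < 1"
begin

lemma rs_coeff_grad_r:
  "rs_coeff (grad_r q f) i j = smult (qnat q (2 * i + 2)) (rs_coeff f (Suc i) j)"
proof -
  have "q\<^sup>2 \<noteq> 1" using q by (simp add: power2_eq_1_iff)
  then show ?thesis
    using qnat_sum_squares[OF q, of i] by (simp add: grad_r_def rs_coeff_mult rs_coeff_qdiff_r)
qed

lemma rs_coeff_grad_s:
  "rs_coeff (grad_s q f) i j = smult (2 * q ^ (2 * i) * qnat q (Suc j)) (rs_coeff f i (Suc j))"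
  using q by (simp add: grad_s_def rs_coeff_mult rs_coeff_shift_r rs_coeff_qdiff_s qnat_sum
      mult.assoc flip: power_mult)

text \<open>A q-analogue of Euler's identity for homogeneous polynomials. The shift in r inside
  \<open>dsc\<close> supplies the factor in [2 i] + q^(2 i) [j] = [2 i + j].\<close>

lemma q_euler_identity:
  "rs_coeff (r_scal * grad_r q f + half_s * grad_s q f) i j = smult (qnat q (2 * i + j)) (rs_coeff f i j)"
proof -
  have "smult (qnat q (2 * i + j)) p = smult (qnat q (2 * i)) p + smult (q ^ (2 * i) * qnat q j) p"
    for p
    using q by (simp only: qnat_add smult_add_left)
  then show ?thesis
    by (cases i; cases j) (simp_all add: rs_coeff_mult rs_coeff_grad_r rs_coeff_grad_s mult.assoc)
qed

lemma grad_add: "grad_r q (f + g) = grad_r q f + grad_r q g"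
    "grad_s q (f + g) = grad_s q f + grad_s q g"
  by (rule scal_eqI; simp add: rs_coeff_grad_r rs_coeff_grad_s smult_add_right)+

text \<open>Both operators act in r and s only, so t is a constant for them. Linearity of the
  derivative over the polynomials in t rests on this.\<close>

lemma grad_mult: "grad_r q ([:[:p:]:] * f) = [:[:p:]:] * grad_r q f"
    "grad_s q ([:[:p:]:] * f) = [:[:p:]:] * grad_s q f"
  by (rule scal_eqI;
      simp only: rs_coeff_grad_r rs_coeff_grad_s rs_coeff_mult; simp)+

lemma deriv_coords_add: "deriv_coords q Q (v + w) = deriv_coords q Q v + deriv_coords q Q w"
  by (cases v; cases w) (simp add: grad_add algebra_simps)

lemma deriv_coords_cscale:
  "deriv_coords q Q (cscale [:[:p:]:] v) = cscale [:[:p:]:] (deriv_coords q Q v)"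
proof (cases v)
  case (fields a b c d)
  define P :: scal where "P = [:[:p:]:]"
  have "deriv_coords q Q (cscale P v) = cscale P (deriv_coords q Q v)"
    by (simp only: fields cscale.simps deriv_coords.simps grad_mult[of p, folded P_def])
       (simp add: algebra_simps)
  then show ?thesis by (simp only: P_def)
qed

lemma grad_0: "grad_r q 0 = 0" "grad_s q 0 = 0"
  using grad_mult[of 0 0] by simp_all

lemma scal_eval_scale: "scal_eval (scal_of_real e * f) = e *\<^sub>R scal_eval f"
  by (simp add: scal_eval_mult scal_eval_of_real scaleR_conv_of_real)

lemma dsc_emb: "dsc q f = emb (0, grad_s q f, grad_r q f, 0)"
  by (simp add: dsc_def grad_s_def grad_r_def scal_eval_scale scal_eval_0)

lemma emb_diff: "emb (v - w) = emb v - emb w"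
  using emb_add[of "v - w" w] by simp

lemma vw_emb: "vw * emb v = emb (left_w v)"
  by (rule coords_eqI) (simp only: coords_mult coords_emb act_vw)

text \<open>Existence for the definite description: \<open>deriv_coords\<close> is the prescribed
  rule with the products by y, x and w expanded by the tables for left multiplication.\<close>

lemma is_qderiv_deriv_coords:
  "is_qderiv q M (\<lambda>F. emb (deriv_coords q (q powi (M - 1)) (coords F)))"
proof -
  let ?Q = "q powi (M - 1)"
  have Q: "q powi M = q * ?Q"
    using q by (simp add: power_int_diff)
  have "linear (\<lambda>F. emb (deriv_coords q ?Q (coords F)))"
  proof (rule linearI)
    fix F G and e :: real
    have "coords (F + G) = coords F + coords G" "coords (e *\<^sub>R F) = cscale (scal_of_real e) (coords F)"
      by (simp_all add: coords_def act_add act_scaleR)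
    then show "emb (deriv_coords q ?Q (coords (F + G)))
        = emb (deriv_coords q ?Q (coords F)) + emb (deriv_coords q ?Q (coords G))"
      "emb (deriv_coords q ?Q (coords (e *\<^sub>R F))) = e *\<^sub>R emb (deriv_coords q ?Q (coords F))"
      by (simp_all only: deriv_coords_add emb_add scal_of_real_def deriv_coords_cscale
          emb_scaleR[unfolded scal_of_real_def])
  qed
  moreover have "scal_eval f = emb (f, 0, 0, 0)" "vy * scal_eval f = emb (0, f, 0, 0)"
    "vx * scal_eval f = emb (0, 0, f, 0)" "vw * scal_eval f = emb (0, 0, 0, f)" for f
    by (simp_all add: scal_eval_0)
  ultimately show ?thesis
    unfolding is_qderiv_def
    by (simp add: dsc_emb vx_emb vy_emb vw_emb emb_scaleR coords_emb grad_0 qnum_def Q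
        algebra_simps flip: emb_add emb_diff del: emb.simps)
       (intro allI arg_cong[where f = emb], simp)
qed

text \<open>By linearity the four prescribed values determine the operator on the range of
  \<open>emb\<close>, which is the whole algebra.\<close>

lemma is_qderiv_unique:
  assumes "is_qderiv q M D" "is_qderiv q M D'"
  shows "D = D'"
proof
  fix F
  obtain a b c d where F: "F = emb (a, b, c, d)"
    by (metis emb_coords prod_cases4)
  have "D (emb (a, b, c, d)) = dsc q a + vy * dsc q b
      + (qnum q M *\<^sub>R scal_eval c + (q powi M) *\<^sub>R (vx * dsc q c))
      + (- (qnum q (M - 1) *\<^sub>R (vy * scal_eval d)) + (q powi (M - 1)) *\<^sub>R (vw * dsc q d))"
    if "is_qderiv q M D" for D
    using that unfolding is_qderiv_def by (simp add: linear_add)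
  from this[OF assms(1)] this[OF assms(2)] show "D F = D' F"
    by (simp only: F)
qed

lemma qderiv_emb: "qderiv q M (emb v) = emb (deriv_coords q (q powi (M - 1)) v)"
proof -
  have "qderiv q M = (\<lambda>F. emb (deriv_coords q (q powi (M - 1)) (coords F)))"
    unfolding qderiv_def
    using is_qderiv_deriv_coords is_qderiv_unique by (intro the_equality) blast+
  then show ?thesis by (simp add: coords_emb)
qed

end

section \<open>Blocks\<close>

text \<open>The offset \<open>e\<close> is the degree in \<open>x\<close> of the basis element that \<open>f\<close> multiplies.\<close>

definition homog :: "nat \<Rightarrow> nat \<Rightarrow> scal \<Rightarrow> bool"
  where "homog e k f \<longleftrightarrow> (\<forall>i j. e + 2 * i + j \<noteq> k \<longrightarrow> rs_coeff f i j = 0)"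

text \<open>The degree forces the exponent of s once that of r is known, so one sequence of
  polynomials in t describes a homogeneous element.\<close>

definition homog_poly :: "nat \<Rightarrow> nat \<Rightarrow> (nat \<Rightarrow> real poly) \<Rightarrow> scal"
  where "homog_poly e k g = (\<Sum>i | e + 2 * i \<le> k. monom (monom (g i) (k - e - 2 * i)) i)"

lemma finite_weights: "finite {i. e + 2 * i \<le> (k::nat)}"
  by (rule finite_subset[of _ "{..k}"]) auto

lemma rs_coeff_hom_poly: "rs_coeff (homog_poly e k g) i j = (if e + 2 * i + j = k then g i else 0)"
proof -
  have "rs_coeff (homog_poly e k g) i j
      = (\<Sum>l | e + 2 * l \<le> k. if l = i then (if j = k - e - 2 * i then g i else 0) else 0)"
    unfolding homog_poly_def coeff_sum by (intro sum.cong refl) (auto simp: coeff_monom)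
  also have "\<dots> = (if e + 2 * i + j = k then g i else 0)"
    using finite_weights by (auto simp: sum.delta)
  finally show ?thesis .
qed

lemma homog_hom_poly: "homog e k (homog_poly e k g)"
  by (simp add: homog_def rs_coeff_hom_poly)

lemma homog_polyI:
  assumes "homog e k f"
  shows "f = homog_poly e k (\<lambda>i. rs_coeff f i (k - e - 2 * i))"
  by (rule scal_eqI) (use assms in \<open>auto simp: homog_def rs_coeff_hom_poly\<close>)

lemma homog_eqI:
  assumes "homog e k f" "homog e k g"
    and "\<And>i. e + 2 * i \<le> k \<Longrightarrow> rs_coeff f i (k - e - 2 * i) = rs_coeff g i (k - e - 2 * i)"
  shows "f = g"
proof (rule scal_eqI)
  fix i j
  show "rs_coeff f i j = rs_coeff g i j"
    using assms(1,2) assms(3)[of i] by (cases "e + 2 * i + j = k") (auto simp: homog_def)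
qed

fun homog_coords :: "nat \<Rightarrow> coords \<Rightarrow> bool"
  where "homog_coords k (a, b, c, d) \<longleftrightarrow> homog 0 k a \<and> homog 0 k b \<and> homog 1 k c \<and> homog 1 k d"

lemma homog_coords_linear:
  "homog_coords k 0"
  "homog_coords k v \<Longrightarrow> homog_coords k w \<Longrightarrow> homog_coords k (v + w)"
  "homog_coords k v \<Longrightarrow> homog_coords k (cscale [:[:p:]:] v)"
  by (cases v; cases w; simp add: homog_def zero_prod_def)+

lemma heval_monom:
  assumes "h 0 = 0"
  shows "heval h z (monom a n) = h a * z ^ n"
  by (induction n)
     (simp_all add: monom_Suc monom_0 heval_pCons assms heval_def[of _ _ 0] mult.assoc power_commutes)

lemma scal_eval_monom: "scal_eval (monom (monom p j) i) = teval p * ss ^ j * sr ^ i"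
  by (simp add: scal_eval_def heval_monom teval_heval_0 teval_0)

lemma scal_eval_sum: "scal_eval (sum f A) = (\<Sum>x\<in>A. scal_eval (f x))"
  by (induction A rule: infinite_finite_induct) (simp_all add: scal_eval_0 scal_eval_add)

lemma powers_commute: "ss ^ j * sr ^ i = sr ^ i * ss ^ j"
  by (metis power_commuting_commutes commute_sr(2))

text \<open>A homogeneous f is a combination of monomials in r and s with coefficients in t, and
  these coefficients can be moved in front of G.\<close>

lemma scal_eval_in_block:
  assumes "G \<in> {1, vx, vy, vw}" "homog e k f"
    and "\<And>i j. e + 2 * i + j = k \<Longrightarrow> G * sr ^ i * ss ^ j \<in> block k"
  shows "G * scal_eval f \<in> block k"
proof -
  have G: "G * teval p = teval p * G" for p
    using assms(1) scal_eval_central[of G "[:[:p:]:]"] unfolding scal_eval_teval by auto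
  have "G * scal_eval (monom (monom p j) i) = tscale p (G * sr ^ i * ss ^ j)" for p i j
    unfolding scal_eval_monom tscale_def by (metis G mult.assoc powers_commute)
  then have "G * scal_eval f
      = (\<Sum>i | e + 2 * i \<le> k. tscale (rs_coeff f i (k - e - 2 * i)) (G * sr ^ i * ss ^ (k - e - 2 * i)))"
    by (subst homog_polyI[OF assms(2)]) (simp add: homog_poly_def scal_eval_sum sum_distrib_left)
  also have "\<dots> \<in> block k"
    unfolding block_def using assms(3)[unfolded block_def]
    by (intro Rt.span_sum Rt.span_scale) auto
  finally show ?thesis .
qed

text \<open>The right-hand side is a submodule containing all generators of the block; conversely
  each homogeneous coordinate contributes a combination of generators.\<close>

lemma block_eq: "block k = emb ` {v. homog_coords k v}"
proof
  have "Rt.subspace (emb ` {v. homog_coords k v})"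
  proof (rule Rt.subspaceI)
    have "emb 0 = 0" by (simp add: zero_prod_def scal_eval_0)
    then show "0 \<in> emb ` {v. homog_coords k v}"
      by (metis homog_coords_linear(1) imageI mem_Collect_eq)
  next
    fix F G assume "F \<in> emb ` {v. homog_coords k v}" "G \<in> emb ` {v. homog_coords k v}"
    then obtain v w where "F + G = emb (v + w)" "homog_coords k v" "homog_coords k w"
      by (auto simp only: emb_add mem_Collect_eq)
    then show "F + G \<in> emb ` {v. homog_coords k v}"
      using homog_coords_linear(2) by blast
  next
    fix p F assume "F \<in> emb ` {v. homog_coords k v}"
    then obtain v where "tscale p F = emb (cscale [:[:p:]:] v)" "homog_coords k v"
      by (auto simp only: emb_tscale mem_Collect_eq)
    then show "tscale p F \<in> emb ` {v. homog_coords k v}"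
      using homog_coords_linear(3) by blast
  qed
  moreover have
    "sr ^ i * ss ^ j = emb (homog_poly 0 k (\<lambda>l. if l = i then 1 else 0), 0, 0, 0)"
    "vy * sr ^ i * ss ^ j = emb (0, homog_poly 0 k (\<lambda>l. if l = i then 1 else 0), 0, 0)"
    if "2 * i + j = k" for i j
  proof -
    have "homog_poly 0 k (\<lambda>l. if l = i then 1 else 0) = monom (monom 1 j) i"
      by (rule scal_eqI) (use that in \<open>auto simp: rs_coeff_hom_poly coeff_monom\<close>)
    then show "sr ^ i * ss ^ j = emb (homog_poly 0 k (\<lambda>l. if l = i then 1 else 0), 0, 0, 0)"
      "vy * sr ^ i * ss ^ j = emb (0, homog_poly 0 k (\<lambda>l. if l = i then 1 else 0), 0, 0)"
      by (simp_all add: scal_eval_0 scal_eval_monom teval_1 powers_commute mult.assoc)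
  qed
  moreover have
    "vx * sr ^ i * ss ^ j = emb (0, 0, homog_poly 1 k (\<lambda>l. if l = i then 1 else 0), 0)"
    "vw * sr ^ i * ss ^ j = emb (0, 0, 0, homog_poly 1 k (\<lambda>l. if l = i then 1 else 0))"
    if "1 + 2 * i + j = k" for i j
  proof -
    have "homog_poly 1 k (\<lambda>l. if l = i then 1 else 0) = monom (monom 1 j) i"
      by (rule scal_eqI) (use that in \<open>auto simp: rs_coeff_hom_poly coeff_monom\<close>)
    then show "vx * sr ^ i * ss ^ j = emb (0, 0, homog_poly 1 k (\<lambda>l. if l = i then 1 else 0), 0)"
      "vw * sr ^ i * ss ^ j = emb (0, 0, 0, homog_poly 1 k (\<lambda>l. if l = i then 1 else 0))"
      by (simp_all add: scal_eval_0 scal_eval_monom teval_1 powers_commute mult.assoc)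
  qed
  moreover have "homog e k 0" for e by (simp add: homog_def)
  ultimately show "block k \<subseteq> emb ` {v. homog_coords k v}"
    unfolding block_def
    by (intro Rt.span_minimal) (auto intro!: imageI simp: homog_hom_poly simp del: emb.simps)
next
  have gen: "2 * i + j = k \<Longrightarrow> 1 * sr ^ i * ss ^ j \<in> block k"
    "2 * i + j = k \<Longrightarrow> vy * sr ^ i * ss ^ j \<in> block k"
    "1 + 2 * i + j = k \<Longrightarrow> vx * sr ^ i * ss ^ j \<in> block k"
    "1 + 2 * i + j = k \<Longrightarrow> vw * sr ^ i * ss ^ j \<in> block k" for i j
    unfolding block_def by (rule Rt.span_base; auto)+
  have "emb (a, b, c, d) \<in> block k" if "homog_coords k (a, b, c, d)" for a b c d
  proof -
    have "1 * scal_eval a \<in> block k" "vy * scal_eval b \<in> block k"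
      by (rule scal_eval_in_block[where e = 0]; use that gen in auto)+
    moreover have "vx * scal_eval c \<in> block k" "vw * scal_eval d \<in> block k"
      by (rule scal_eval_in_block[where e = 1]; use that gen in auto)+
    ultimately show ?thesis
      unfolding block_def by (simp add: Rt.span_add)
  qed
  then show "emb ` {v. homog_coords k v} \<subseteq> block k" by auto
qed

lemma homog_coords_right_x: "homog_coords k v \<Longrightarrow> homog_coords (k + 1) (right_x v)"
  by (cases v) (auto simp: homog_def rs_coeff_mult split: nat.splits)

lemma homog_coords_deriv:
  assumes "0 < q" "q < 1" "homog_coords (k + 1) v"
  shows "homog_coords k (deriv_coords q Q v)"
  using assms(3)
  by (cases v)
     (auto simp: homog_def rs_coeff_mult rs_coeff_grad_r[OF assms(1,2)] rs_coeff_grad_s[OF assms(1,2)]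
       split: nat.splits)

section \<open>The triangular systems\<close>

text \<open>The effect on coefficients of multiplication by a variable: a shift by one index with 0
  in the first place.\<close>

abbreviation prev :: "(nat \<Rightarrow> 'a::zero) \<Rightarrow> nat \<Rightarrow> 'a"
  where "prev f i \<equiv> (case i of 0 \<Rightarrow> 0 | Suc i' \<Rightarrow> f i')"

lemma ex_prev_recursion: "\<exists>f :: nat \<Rightarrow> 'a::zero. \<forall>i. f i = F i (prev f i)"
proof
  define f where "f = rec_nat (F 0 0) (\<lambda>i. F (Suc i))"
  show "\<forall>i. f i = F i (prev f i)"
    by (simp add: f_def split: nat.split)
qed

lemma smult_solve: "c \<noteq> 0 \<Longrightarrow> smult c (smult (inverse c) p) = p" for c :: "'a::field"
  by simp

text \<open>The substitution \<open>u i = a i + d i / 2\<close> makes the two equations triangular.\<close>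

lemma solve_1_w:
  fixes A D :: "nat \<Rightarrow> real poly" and n :: real and e g p :: "nat \<Rightarrow> real"
  assumes n: "n > 0" and e: "\<And>i. k < 2 * i \<Longrightarrow> e i = 0"
    and g: "\<And>i. 0 \<le> g i" "\<And>i. k \<le> 2 * i \<Longrightarrow> g i = 0" and p: "\<And>i. 0 < p i"
    and A: "\<And>i. k < 2 * i \<Longrightarrow> A i = 0" and D: "\<And>i. k \<le> 2 * i \<Longrightarrow> D i = 0"
  shows "\<exists>a d.
    (\<forall>i. smult n (a i + smult (1/2) (d i)) - smult (p i / 2) (d i)
      - smult (2 * e i) (pCons 0 (prev d i)) = A i) \<and>
    (\<forall>i. smult (p i) (d i) + smult (2 * g i) (a i + smult (1/2) (d i)) = D i) \<and>
    (\<forall>i. k < 2 * i \<longrightarrow> a i = 0) \<and> (\<forall>i. k \<le> 2 * i \<longrightarrow> d i = 0)"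
proof -
  \<comment> \<open>\<open>U\<close> is the value of u i for given d (i - 1): replacing p d by D - 2
    g u in the first equation leaves (n + g) u = A + D/2 + 2 e t d (i - 1).\<close>
  define U where "U i x = smult (inverse (n + g i)) (A i + smult (1/2) (D i) + smult (2 * e i) (pCons 0 x))"
    for i x
  obtain d where d: "\<And>i. d i = smult (inverse (p i)) (D i - smult (2 * g i) (U i (prev d i)))"
    using ex_prev_recursion[of "\<lambda>i x. smult (inverse (p i)) (D i - smult (2 * g i) (U i x))"] by blast
  define u where "u i = U i (prev d i)" for i
  define a where "a i = u i - smult (1/2) (d i)" for i
  have "n + g i \<noteq> 0" "p i \<noteq> 0" for i using n g(1)[of i] p[of i] by auto
  then have u: "smult (n + g i) (u i) = A i + smult (1/2) (D i) + smult (2 * e i) (pCons 0 (prev d i))"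
    for i
    unfolding u_def U_def by (intro smult_solve)
  have pd: "smult (p i) (d i) = D i - smult (2 * g i) (u i)" for i
    using smult_solve[OF \<open>p i \<noteq> 0\<close>, of "D i - smult (2 * g i) (u i)"]
    by (simp only: d[of i, folded u_def, symmetric])
  have au: "a i + smult (1/2) (d i) = u i" for i by (simp add: a_def)
  show ?thesis
  proof (rule exI[of _ a], rule exI[of _ d], intro conjI allI impI)
    fix i
    show "smult (p i) (d i) + smult (2 * g i) (a i + smult (1/2) (d i)) = D i"
      by (simp only: au pd diff_add_cancel)
    have "smult (p i / 2) (d i) = smult (1/2) (smult (p i) (d i))" by simp
    also have "\<dots> = smult (1/2) (D i) - smult (g i) (u i)"
      by (simp add: pd smult_diff_right)
    finally show "smult n (a i + smult (1/2) (d i)) - smult (p i / 2) (d i)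
      - smult (2 * e i) (pCons 0 (prev d i)) = A i"
      using u[of i] unfolding au by (simp add: smult_add_left algebra_simps)
    show d0: "d i = 0" if "k \<le> 2 * i" for i
      using that by (subst d) (simp add: D g)
    \<comment> \<open>For k = 2 i - 1 the entry d (i - 1) may be nonzero, but its factor
      \<open>e i\<close> vanishes.\<close>
    show "a i = 0" if "k < 2 * i"
      using that by (simp add: a_def u_def U_def d0 e A D)
  qed
qed

text \<open>Eliminating \<open>c (i - 1)\<close> from the first equation by means of the second one leaves a
  two-term recursion for \<open>b\<close>.\<close>

lemma solve_y_x:
  fixes B C :: "nat \<Rightarrow> real poly" and n Q :: real and e g p :: "nat \<Rightarrow> real"
  assumes n: "n \<ge> 0" and Q: "Q > 0"
    and e: "\<And>i. k < 2 * i \<Longrightarrow> e i = 0" "\<And>i. 2 * i \<le> k \<Longrightarrow> 0 < e i"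
    and g: "\<And>i. k \<le> 2 * i \<Longrightarrow> g i = 0" and p: "\<And>i. 0 < p i"
    and B: "\<And>i. k < 2 * i \<Longrightarrow> B i = 0" and C: "\<And>i. k \<le> 2 * i \<Longrightarrow> C i = 0"
  shows "\<exists>b c.
    (\<forall>i. smult (e i) (b i + smult 2 (prev c i)) + smult n (b i) = B i) \<and>
    (\<forall>i. smult (p i) (c i + smult (1/2) (b (Suc i))) - smult (Q * p i / 2) (b (Suc i))
      - smult (2 * Q * g i) (pCons 0 (b i)) = C i) \<and>
    (\<forall>i. k < 2 * i \<longrightarrow> b i = 0) \<and> (\<forall>i. k \<le> 2 * i \<longrightarrow> c i = 0)"
proof -
  \<comment> \<open>The second equation states c i + ((1 - Q)/2) b (i + 1) =
    \<open>W i (b i)\<close>.\<close>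
  define W where "W i x = smult (inverse (p i)) (C i + smult (2 * Q * g i) (pCons 0 x))" for i x
  \<comment> \<open>Inserting c (i - 1) leaves e b i - (1 - Q) e b i = Q e b i. For i = 0 there is
    no c (i - 1), so the factor is 1.\<close>
  define N where "N i = n + (if i = 0 then 1 else Q) * e i" for i
  define F where "F i x = smult (inverse (N i)) (B i - smult (2 * e i) (if i = 0 then 0 else W (i - 1) x))"
    for i x
  obtain b where b: "\<And>i. b i = F i (prev b i)"
    using ex_prev_recursion[of F] by blast
  define c where "c i = W i (b i) - smult ((1 - Q) / 2) (b (Suc i))" for i
  have b0: "b i = 0" if "k < 2 * i" for i
    using that by (subst b) (simp add: F_def e B)
  have W: "smult (p i) (W i x) = C i + smult (2 * Q * g i) (pCons 0 x)" for i x
    unfolding W_def using p[of i] by (intro smult_solve) simp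
  \<comment> \<open>For k < 2 i the divisor is n, which may be 0; there both sides vanish
    anyway.\<close>
  have N: "smult (N i) (b i) = B i - smult (2 * e i) (if i = 0 then 0 else W (i - 1) (prev b i))" for i
  proof (cases "k < 2 * i")
    case True
    then show ?thesis using b0 e B by simp
  next
    case False
    then have "N i > 0" unfolding N_def using e(2)[of i] n Q by (auto intro!: add_nonneg_pos)
    then show ?thesis by (subst b) (simp add: F_def)
  qed
  show ?thesis
  proof (rule exI[of _ b], rule exI[of _ c], intro conjI allI impI)
    fix i
    show "smult (e i) (b i + smult 2 (prev c i)) + smult n (b i) = B i"
    proof (cases i)
      case 0
      then show ?thesis using N[of 0] by (simp add: N_def smult_add_left)
    next
      case (Suc i')
      have "smult 2 (c i') = smult 2 (W i' (b i')) - smult (1 - Q) (b i)"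
        by (simp add: c_def Suc smult_diff_right diff_divide_distrib)
      then have "smult (e i) (smult 2 (c i')) = smult (2 * e i) (W i' (b i')) - smult ((1 - Q) * e i) (b i)"
        by (simp add: smult_diff_right mult.commute)
      then show ?thesis using N[of i] Suc
        by (simp add: N_def smult_add_left smult_diff_left smult_add_right algebra_simps)
    qed
    show "smult (p i) (c i + smult (1/2) (b (Suc i))) - smult (Q * p i / 2) (b (Suc i))
      - smult (2 * Q * g i) (pCons 0 (b i)) = C i"
    proof -
      have "c i + smult (1/2) (b (Suc i)) = W i (b i) + smult (Q / 2) (b (Suc i))"
        by (simp add: c_def diff_divide_distrib smult_diff_left)
      then show ?thesis
        by (simp only: smult_add_right W) (simp add: mult.commute)
    qed
    show "b i = 0" if "k < 2 * i" using that b0 by simp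
    show "c i = 0" if "k \<le> 2 * i"
      using that by (simp add: c_def W_def b0 C g)
  qed
qed

text \<open>The elimination of \<open>solve_1_w\<close> with zero right-hand sides: once d (i - 1) =
  0, the sum u = a i + d i / 2 satisfies (n + g) u = 0, and then p d = 0.\<close>

lemma unique_1_w:
  fixes n :: real and a d :: "nat \<Rightarrow> real poly"
  assumes n: "n > 0" and g: "\<And>i. 0 \<le> g i" and p: "\<And>i. 0 < p i"
    and 1: "\<And>i. smult n (a i + smult (1/2) (d i)) - smult (p i / 2) (d i)
      - smult (2 * e i) (pCons 0 (prev d i)) = 0"
    and w: "\<And>i. smult (p i) (d i) + smult (2 * g i) (a i + smult (1/2) (d i)) = 0"
  shows "a i = 0 \<and> d i = 0"
proof (induction i)
  \<comment> \<open>This serves the base case and the induction step alike, since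
    \<open>prev d 0\<close> is 0.\<close>
  have *: "a i = 0 \<and> d i = 0" if "prev d i = 0" for i
  proof -
    let ?u = "a i + smult (1/2) (d i)"
    have "smult (p i) (d i) = - smult (2 * g i) ?u"
      using w[of i] by (simp only: eq_neg_iff_add_eq_0)
    moreover have "smult (p i / 2) (d i) = smult (1/2) (smult (p i) (d i))" by simp
    ultimately have "smult (p i / 2) (d i) = - smult (g i) ?u"
      by (simp only: smult_minus_right) (simp del: smult_add_right)
    then have "smult (n + g i) ?u = 0"
      using 1[of i] that by (simp only: smult_add_left) simp
    then have "?u = 0" using n g[of i] by (simp add: add_nonneg_eq_0_iff)
    moreover from this have "d i = 0" using w[of i] p[of i] by (simp only:) simp
    ultimately show ?thesis by simp
  qed
  case 0
  show ?case by (rule *) simp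
  case (Suc i)
  then show ?case by (intro *) simp
qed

text \<open>If b i = 0, the second equation gives c i = ((Q - 1)/2) b (i + 1). The first equation at
  i + 1 then reads (Q e + n) b (i + 1) = 0.\<close>

lemma unique_y_x:
  fixes n Q :: real and b c :: "nat \<Rightarrow> real poly"
  assumes n: "n \<ge> 0" and Q: "Q > 0" and e: "\<And>i. 2 * i \<le> k \<Longrightarrow> 0 < e i" and p: "\<And>i. 0 < p i"
    and y: "\<And>i. smult (e i) (b i + smult 2 (prev c i)) + smult n (b i) = 0"
    and x: "\<And>i. smult (p i) (c i + smult (1/2) (b (Suc i))) - smult (Q * p i / 2) (b (Suc i))
      - smult (2 * Q * g i) (pCons 0 (b i)) = 0"
    and b: "\<And>i. k < 2 * i \<Longrightarrow> b i = 0"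
  shows "b i = 0 \<and> c i = 0"
proof -
  have c: "c i = smult ((Q - 1) / 2) (b (Suc i))" if "b i = 0" for i
  proof -
    have "smult (p i) (c i + smult (1/2) (b (Suc i)) - smult (Q / 2) (b (Suc i))) = 0"
      using x[of i] that by (simp add: smult_diff_right mult.commute)
    then have "c i + smult (1/2) (b (Suc i)) - smult (Q / 2) (b (Suc i)) = 0"
      using p[of i] by simp
    then show ?thesis by (simp add: diff_divide_distrib smult_diff_left algebra_simps)
  qed
  have "b i = 0" for i
  proof (induction i)
    case 0
    have "smult (e 0 + n) (b 0) = 0" using y[of 0] by (simp add: smult_add_left)
    then show ?case using e[of 0] n by (simp add: add_pos_nonneg)
  next
    case (Suc i)
    have "smult (Q * e (Suc i) + n) (b (Suc i)) = 0"
      using y[of "Suc i"] c[OF Suc]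
      by (simp add: smult_add_left smult_add_right diff_divide_distrib smult_diff_left
          smult_diff_right algebra_simps)
    moreover have "Q * e (Suc i) + n > 0" if "2 * Suc i \<le> k"
      using e[OF that] n Q by (simp add: add_pos_nonneg)
    ultimately show ?case using b[of "Suc i"] by (cases "2 * Suc i \<le> k") auto
  qed
  then show ?thesis using c by simp
qed

section \<open>Coefficients of the derivative after right multiplication\<close>

lemma emb_inj: "emb v = emb w \<longleftrightarrow> v = w"
  by (metis coords_emb)

text \<open>The coordinates of x and w have offset 1, and k - 1 - 2 (i - 1) = k - 2 i + 1.\<close>

lemma prev_shift:
  assumes "2 * i \<le> k"
  shows "prev (\<lambda>l. rs_coeff f l (Suc (k - 2 * i))) i = prev (\<lambda>l. rs_coeff f l (k - 1 - 2 * l)) i"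
proof (cases i)
  case (Suc n)
  then have "Suc (k - 2 * Suc n) = k - 1 - 2 * n" using assms by simp
  then show ?thesis by (simp only: Suc nat.case)
qed simp

text \<open>This is \<open>[M - 1 + n]\<close> for \<open>Q = q\<^sup>M\<^sup>-\<^sup>1\<close>.\<close>

definition shifted_qnat :: "real \<Rightarrow> real \<Rightarrow> nat \<Rightarrow> real"
  where "shifted_qnat q Q n = (1 - Q * q ^ n) / (1 - q)"

context
  fixes q Q :: real
  assumes q: "0 < q" "q < 1"
begin

lemma shifted_qnat_eq:
  "(1 - Q) / (1 - q) + Q * qnat q n = shifted_qnat q Q n"
  "(1 - q * Q) / (1 - q) + q * Q * qnat q n = shifted_qnat q Q (Suc n)"
  using q by (simp_all add: shifted_qnat_def qnat_def field_simps)

text \<open>For Q = q^(M-1) the constant term of the derivative joins the q-Euler eigenvalue by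
  [M - 1] + q^(M-1) [n] = [M - 1 + n]. The second identity is the same with M in place of M -
  1.\<close>

lemma q_euler_identity_shifted:
  "rs_coeff (scal_of_real ((1 - Q) / (1 - q)) * f
     + scal_of_real Q * (r_scal * grad_r q f + half_s * grad_s q f)) i j
   = smult (shifted_qnat q Q (2 * i + j)) (rs_coeff f i j)"
  "rs_coeff (scal_of_real ((1 - q * Q) / (1 - q)) * f
     + scal_of_real (q * Q) * (r_scal * grad_r q f + half_s * grad_s q f)) i j
   = smult (shifted_qnat q Q (Suc (2 * i + j))) (rs_coeff f i j)"
  unfolding coeff_add[of "_ * _" "_ * (_ + _)"] coeff_add[of "coeff (_ * _) _"] rs_coeff_mult(1)
    q_euler_identity[OF q] smult_smult smult_add_left[symmetric] shifted_qnat_eq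
  by (rule refl)+

text \<open>The system decouples into (a, d) and (b, c). The variable t, visible as
  \<open>pCons 0\<close>, only links a diagonal block, (a i, d i) or (c (i - 1), b i), to the
  preceding one.\<close>

lemma deriv_right_x_rs_coeff:
  assumes w: "deriv_coords q Q (right_x (a, b, c, d)) = (a', b', c', d')"
  shows
    "rs_coeff a' i j =
      smult (shifted_qnat q Q (Suc (2 * i + j))) (rs_coeff a i j + smult (1/2) (prev (rs_coeff d i) j))
      - smult (qnat q (2 * i + 2) / 2) (prev (rs_coeff d i) j)
      - smult (2 * (q ^ (2 * i) * qnat q (Suc j))) (pCons 0 (prev (\<lambda>i. rs_coeff d i (Suc j)) i))"
    "rs_coeff b' i j =
      smult (q ^ (2 * i) * qnat q (Suc j)) (rs_coeff b i j + smult 2 (prev (\<lambda>i. rs_coeff c i (Suc j)) i))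
      + smult (shifted_qnat q Q (2 * i + j)) (rs_coeff b i j)"
    "rs_coeff c' i j =
      smult (qnat q (2 * i + 2)) (rs_coeff c i j + smult (1/2) (prev (rs_coeff b (Suc i)) j))
      - smult (Q * qnat q (2 * i + 2) / 2) (prev (rs_coeff b (Suc i)) j)
      - smult (2 * Q * (q ^ (2 * i) * qnat q (Suc j))) (pCons 0 (rs_coeff b i (Suc j)))"
    "rs_coeff d' i j =
      smult (qnat q (2 * i + 2)) (rs_coeff d i j)
      + smult (2 * (q * Q * (q ^ (2 * i) * qnat q (Suc j)))) (rs_coeff a i (Suc j) + smult (1/2) (rs_coeff d i j))"
proof -
  define A where "A = half_s * b + r_scal * c"
  define B where "B = - (r_scal * d)"
  define C where "C = a + half_s * d"
  define E where "E = - b"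
  note grad = rs_coeff_grad_r[OF q] rs_coeff_grad_s[OF q]
  have a': "a' = half_s * grad_r q B + t_scal * grad_s q B
      + (scal_of_real ((1 - q * Q) / (1 - q)) * C
         + scal_of_real (q * Q) * (r_scal * grad_r q C + half_s * grad_s q C))"
    and b': "b' = grad_s q A - (scal_of_real ((1 - Q) / (1 - q)) * E
       + scal_of_real Q * (r_scal * grad_r q E + half_s * grad_s q E))"
    and c': "c' = grad_r q A + scal_of_real Q * (t_scal * grad_s q E + half_s * grad_r q E)"
    and d': "d' = scal_of_real (q * Q) * grad_s q C - grad_r q B"
    using w by (simp_all add: A_def B_def C_def E_def)
  have "rs_coeff a' i j = rs_coeff (half_s * grad_r q B) i j + rs_coeff (t_scal * grad_s q B) i j
     + smult (shifted_qnat q Q (Suc (2 * i + j))) (rs_coeff C i j)"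
    unfolding a' by (simp only: coeff_add[of "_ + _" "_ + _"] coeff_add[of "coeff (_ + _) _"] q_euler_identity_shifted) simp
  then show "rs_coeff a' i j =
      smult (shifted_qnat q Q (Suc (2 * i + j))) (rs_coeff a i j + smult (1/2) (prev (rs_coeff d i) j))
      - smult (qnat q (2 * i + 2) / 2) (prev (rs_coeff d i) j)
      - smult (2 * (q ^ (2 * i) * qnat q (Suc j))) (pCons 0 (prev (\<lambda>i. rs_coeff d i (Suc j)) i))"
    by (cases i; cases j) (simp_all add: C_def B_def rs_coeff_mult grad smult_add_right mult.assoc)
  have "rs_coeff b' i j = rs_coeff (grad_s q A) i j - smult (shifted_qnat q Q (2 * i + j)) (rs_coeff E i j)"
    unfolding b' by (simp only: coeff_diff q_euler_identity_shifted)
  then show "rs_coeff b' i j =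
      smult (q ^ (2 * i) * qnat q (Suc j)) (rs_coeff b i j + smult 2 (prev (\<lambda>i. rs_coeff c i (Suc j)) i))
      + smult (shifted_qnat q Q (2 * i + j)) (rs_coeff b i j)"
    by (cases i) (simp_all add: A_def E_def rs_coeff_mult grad smult_add_right mult.commute mult.left_commute)
  show "rs_coeff c' i j =
      smult (qnat q (2 * i + 2)) (rs_coeff c i j + smult (1/2) (prev (rs_coeff b (Suc i)) j))
      - smult (Q * qnat q (2 * i + 2) / 2) (prev (rs_coeff b (Suc i)) j)
      - smult (2 * Q * (q ^ (2 * i) * qnat q (Suc j))) (pCons 0 (rs_coeff b i (Suc j)))"
    unfolding c'
    by (cases j) (simp_all add: A_def E_def rs_coeff_mult grad smult_add_right smult_diff_right mult_ac)
  show "rs_coeff d' i j =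
      smult (qnat q (2 * i + 2)) (rs_coeff d i j)
      + smult (2 * (q * Q * (q ^ (2 * i) * qnat q (Suc j)))) (rs_coeff a i (Suc j) + smult (1/2) (rs_coeff d i j))"
    unfolding d'
    by (simp add: B_def C_def rs_coeff_mult grad smult_add_right mult.commute mult.left_commute)
qed

text \<open>Natural number subtraction truncates, but the equations hold for all \<open>i\<close>: outside the
  range of exponents both sides vanish.\<close>

lemma deriv_right_x_sequences:
  assumes v: "homog_coords k (a, b, c, d)"
    and w: "deriv_coords q Q (right_x (a, b, c, d)) = (a', b', c', d')"
  defines "a0 \<equiv> \<lambda>i. rs_coeff a i (k - 2 * i)" and "b0 \<equiv> \<lambda>i. rs_coeff b i (k - 2 * i)"
    and "c0 \<equiv> \<lambda>i. rs_coeff c i (k - 1 - 2 * i)" and "d0 \<equiv> \<lambda>i. rs_coeff d i (k - 1 - 2 * i)"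
  shows
    "rs_coeff a' i (k - 2 * i) =
      smult (shifted_qnat q Q (Suc k)) (a0 i + smult (1/2) (d0 i))
      - smult (qnat q (2 * i + 2) / 2) (d0 i)
      - smult (2 * (q ^ (2 * i) * qnat q (Suc k - 2 * i))) (pCons 0 (prev d0 i))" (is ?A)
    "rs_coeff b' i (k - 2 * i) =
      smult (q ^ (2 * i) * qnat q (Suc k - 2 * i)) (b0 i + smult 2 (prev c0 i))
      + smult (shifted_qnat q Q k) (b0 i)" (is ?B)
    "rs_coeff c' i (k - 1 - 2 * i) =
      smult (qnat q (2 * i + 2)) (c0 i + smult (1/2) (b0 (Suc i)))
      - smult (Q * qnat q (2 * i + 2) / 2) (b0 (Suc i))
      - smult (2 * Q * (q ^ (2 * i) * qnat q (k - 2 * i))) (pCons 0 (b0 i))" (is ?C)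
    "rs_coeff d' i (k - 1 - 2 * i) =
      smult (qnat q (2 * i + 2)) (d0 i)
      + smult (2 * (q * Q * (q ^ (2 * i) * qnat q (k - 2 * i)))) (a0 i + smult (1/2) (d0 i))" (is ?D)
proof -
  have homog': "homog 0 k a'" "homog 0 k b'" "homog 1 k c'" "homog 1 k d'"
    using homog_coords_deriv[OF q homog_coords_right_x[OF v], of Q] w by simp_all
  note coeffs = deriv_right_x_rs_coeff[OF w]
  show ?A
  proof (cases "2 * i \<le> k")
    case True
    have "prev (rs_coeff d i) (k - 2 * i) = d0 i"
    proof (cases "k - 2 * i")
      case (Suc n)
      then have "k - 1 - 2 * i = n" by simp
      then show ?thesis using Suc by (simp add: d0_def)
    qed (use v in \<open>auto simp: d0_def homog_def\<close>)
    then show ?thesis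
      using True unfolding coeffs(1) prev_shift[OF True] a0_def d0_def by (simp add: Suc_diff_le)
  qed (use v homog' in \<open>auto simp: a0_def d0_def homog_def\<close>)
  show ?B
  proof (cases "2 * i \<le> k")
    case True
    then show ?thesis
      unfolding coeffs(2) prev_shift[OF True] b0_def c0_def by (simp add: Suc_diff_le)
  qed (use v homog' in \<open>auto simp: b0_def c0_def homog_def\<close>)
  show ?C
  proof (cases "1 + 2 * i \<le> k")
    case True
    have "prev (rs_coeff b (Suc i)) (k - 1 - 2 * i) = b0 (Suc i)"
    proof (cases "k - 1 - 2 * i")
      case (Suc n)
      then have "k - 2 * Suc i = n" by simp
      then show ?thesis by (simp only: b0_def Suc nat.case)
    qed (use v True in \<open>auto simp: b0_def homog_def\<close>)
    moreover have "Suc (k - 1 - 2 * i) = k - 2 * i" using True by simp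
    ultimately show ?thesis
      unfolding coeffs(3) by (simp only: b0_def c0_def)
  qed (use v homog' in \<open>auto simp: b0_def c0_def homog_def\<close>)
  show ?D
  proof (cases "1 + 2 * i \<le> k")
    case True
    then have "Suc (k - 1 - 2 * i) = k - 2 * i" by simp
    then show ?thesis
      unfolding coeffs(4) by (simp only: a0_def d0_def)
  qed (use v homog' in \<open>auto simp: a0_def d0_def homog_def\<close>)
qed

end

section \<open>Bijectivity of the composition on a block\<close>

context
  fixes q Q :: real and k :: nat
  assumes q: "0 < q" "q < 1" and Q: "0 < Q" "Q \<le> 1"
begin

text \<open>Equality occurs for Q = 1 and n = 0, that is for M = 1 in degree 0. The (y, x)-system
  then owes its solvability to \<open>e\<close>.\<close>

lemma shifted_qnat_nonneg: "0 \<le> shifted_qnat q Q n"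
proof -
  have "Q * q ^ n \<le> 1" using q Q by (intro mult_le_one) (simp_all add: power_le_one)
  then show ?thesis using q by (simp add: shifted_qnat_def)
qed

text \<open>The additional factor q gives strictness even for Q = 1; the (1, w)-system relies on
  it.\<close>

lemma shifted_qnat_Suc_pos: "0 < shifted_qnat q Q (Suc n)"
proof -
  have "Q * q ^ Suc n < 1 * 1"
    using q Q power_Suc_less_one[of q n] by (intro mult_le_less_imp_less) auto
  then show ?thesis using q by (simp add: shifted_qnat_def)
qed

lemma deriv_right_x_inj:
  assumes v: "homog_coords k v" and 0: "deriv_coords q Q (right_x v) = 0"
  shows "v = 0"
proof (cases v)
  case (fields a b c d)
  let ?a = "\<lambda>i. rs_coeff a i (k - 2 * i)" and ?b = "\<lambda>i. rs_coeff b i (k - 2 * i)"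
    and ?c = "\<lambda>i. rs_coeff c i (k - 1 - 2 * i)" and ?d = "\<lambda>i. rs_coeff d i (k - 1 - 2 * i)"
  have v': "homog_coords k (a, b, c, d)"
    and "deriv_coords q Q (right_x (a, b, c, d)) = (0, 0, 0, 0)"
    using v 0 by (simp_all add: fields zero_prod_def)
  note seq = deriv_right_x_sequences[OF q this, unfolded coeff_0, symmetric]
  have "?a i = 0 \<and> ?d i = 0" for i
    by (rule unique_1_w[where a = ?a and d = ?d, OF _ _ _ seq(1) seq(4)])
       (use q Q in \<open>simp_all add: qnat_pos qnat_nonneg shifted_qnat_Suc_pos\<close>)
  moreover have "?b i = 0 \<and> ?c i = 0" for i
    by (rule unique_y_x[where b = ?b and c = ?c and k = k, OF shifted_qnat_nonneg Q(1) _ _ seq(2) seq(3)])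
       (use q v' in \<open>auto simp: qnat_pos homog_def\<close>)
  moreover have "homog e k 0" for e by (simp add: homog_def)
  ultimately have zero: "?a i = 0" "?b i = 0" "?c i = 0" "?d i = 0" "homog e k 0" for i e
    by blast+
  have "a = 0" "b = 0"
    by (rule homog_eqI[of 0 k]; use v' zero in simp)+
  moreover have "c = 0" "d = 0"
    by (rule homog_eqI[of 1 k]; use v' zero in simp)+
  ultimately show ?thesis by (simp add: fields zero_prod_def)
qed

lemma deriv_right_x_surj:
  assumes w: "homog_coords k w"
  obtains v where "homog_coords k v" "deriv_coords q Q (right_x v) = w"
proof (cases w)
  case (fields \<alpha> \<beta> \<gamma> \<delta>)
  let ?n = "shifted_qnat q Q"
  let ?e = "\<lambda>i. q ^ (2 * i) * qnat q (Suc k - 2 * i)"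
  let ?g = "\<lambda>i. q ^ (2 * i) * qnat q (k - 2 * i)"
  let ?p = "\<lambda>i. qnat q (2 * i + 2)"
  have homog: "homog 0 k \<alpha>" "homog 0 k \<beta>" "homog 1 k \<gamma>" "homog 1 k \<delta>"
    using w fields by auto
  then have vanish: "k < 2 * i \<Longrightarrow> rs_coeff \<alpha> i (k - 2 * i) = 0"
    "k < 2 * i \<Longrightarrow> rs_coeff \<beta> i (k - 2 * i) = 0"
    "k \<le> 2 * i \<Longrightarrow> rs_coeff \<gamma> i (k - 1 - 2 * i) = 0"
    "k \<le> 2 * i \<Longrightarrow> rs_coeff \<delta> i (k - 1 - 2 * i) = 0" for i
    by (auto simp: homog_def)
  have e: "k < 2 * i \<Longrightarrow> ?e i = 0" "2 * i \<le> k \<Longrightarrow> 0 < ?e i"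
    and g: "k \<le> 2 * i \<Longrightarrow> ?g i = 0" and p: "0 < ?p i" for i
    using q by (simp_all add: qnat_pos)
  have qQg: "0 \<le> q * Q * ?g i" "k \<le> 2 * i \<Longrightarrow> q * Q * ?g i = 0" for i
    using q Q by (simp_all add: qnat_nonneg)
  obtain a d where ad:
    "\<And>i. smult (?n (Suc k)) (a i + smult (1/2) (d i)) - smult (?p i / 2) (d i)
      - smult (2 * ?e i) (pCons 0 (prev d i)) = rs_coeff \<alpha> i (k - 2 * i)"
    "\<And>i. smult (?p i) (d i) + smult (2 * (q * Q * ?g i)) (a i + smult (1/2) (d i))
      = rs_coeff \<delta> i (k - 1 - 2 * i)"
    "\<And>i. k < 2 * i \<Longrightarrow> a i = 0" "\<And>i. k \<le> 2 * i \<Longrightarrow> d i = 0"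
    using solve_1_w[where k = k and n = "?n (Suc k)" and e = ?e and g = "\<lambda>i. q * Q * ?g i" and p = ?p
        and A = "\<lambda>i. rs_coeff \<alpha> i (k - 2 * i)" and D = "\<lambda>i. rs_coeff \<delta> i (k - 1 - 2 * i)"]
      shifted_qnat_Suc_pos e(1) qQg p vanish(1,4) by blast
  obtain b c where bc:
    "\<And>i. smult (?e i) (b i + smult 2 (prev c i)) + smult (?n k) (b i) = rs_coeff \<beta> i (k - 2 * i)"
    "\<And>i. smult (?p i) (c i + smult (1/2) (b (Suc i))) - smult (Q * ?p i / 2) (b (Suc i))
      - smult (2 * Q * ?g i) (pCons 0 (b i)) = rs_coeff \<gamma> i (k - 1 - 2 * i)"
    "\<And>i. k < 2 * i \<Longrightarrow> b i = 0" "\<And>i. k \<le> 2 * i \<Longrightarrow> c i = 0"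
    using solve_y_x[where k = k and n = "?n k" and Q = Q and e = ?e and g = ?g and p = ?p
        and B = "\<lambda>i. rs_coeff \<beta> i (k - 2 * i)" and C = "\<lambda>i. rs_coeff \<gamma> i (k - 1 - 2 * i)"]
      shifted_qnat_nonneg Q(1) e g p vanish(2,3) by blast
  let ?v = "(homog_poly 0 k a, homog_poly 0 k b, homog_poly 1 k c, homog_poly 1 k d)"
  \<comment> \<open>Truncated subtraction would misread entries beyond the range of exponents, but
    the solutions vanish there.\<close>
  have seq: "(\<lambda>i. rs_coeff (homog_poly 0 k a) i (k - 2 * i)) = a"
    "(\<lambda>i. rs_coeff (homog_poly 0 k b) i (k - 2 * i)) = b"
    "(\<lambda>i. rs_coeff (homog_poly 1 k c) i (k - 1 - 2 * i)) = c"
    "(\<lambda>i. rs_coeff (homog_poly 1 k d) i (k - 1 - 2 * i)) = d"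
    using ad(3,4) bc(3,4) by (auto simp: rs_coeff_hom_poly fun_eq_iff not_le)
  have v: "homog_coords k ?v" by (simp add: homog_hom_poly)
  obtain \<alpha>' \<beta>' \<gamma>' \<delta>' where v': "deriv_coords q Q (right_x ?v) = (\<alpha>', \<beta>', \<gamma>', \<delta>')"
    by (metis prod_cases4)
  have homog': "homog 0 k \<alpha>'" "homog 0 k \<beta>'" "homog 1 k \<gamma>'" "homog 1 k \<delta>'"
    using homog_coords_deriv[OF q homog_coords_right_x[OF v], of Q] v' by simp_all
  note eqs = deriv_right_x_sequences[OF q v v', unfolded seq fun_cong[OF seq(1)] fun_cong[OF seq(2)]
      fun_cong[OF seq(3)] fun_cong[OF seq(4)] ad(1,2) bc(1,2)]
  have "\<alpha>' = \<alpha>" "\<beta>' = \<beta>"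
    by (rule homog_eqI[of 0 k]; use homog homog' eqs(1,2) in simp)+
  moreover have "\<gamma>' = \<gamma>" "\<delta>' = \<delta>"
    by (rule homog_eqI[of 1 k]; use homog homog' eqs(3,4) in simp)+
  ultimately show thesis
    using that[OF v] v' fields by simp
qed

end

section \<open>Splitting off the kernel\<close>

theorem corollary6p2:
  fixes q :: real and M :: int and k :: nat
  assumes "0 < q" and "q < 1" and "M \<ge> 1"
  shows "Rt_direct_sum (block (k + 1))
           {F \<in> block (k + 1). qderiv q M F = 0}
           (right_mult_x ` block k)"
proof -
  define Q where "Q = q powi (M - 1)"
  have q: "0 < q" "q < 1" by fact+
  \<comment> \<open>Here \<open>M \<ge> 1\<close> enters: the exponent M - 1 is nonnegative, so Q is
    at most 1.\<close>
  have Q: "0 < Q" "Q \<le> 1"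
    using assms by (simp_all add: Q_def power_int_def power_le_one)
  let ?D = "qderiv q M" and ?K = "{F \<in> block (k + 1). qderiv q M F = 0}"
  have D_emb: "?D (emb v) = emb (deriv_coords q Q v)" for v
    unfolding Q_def using qderiv_emb[OF q] .
  have emb_0: "emb 0 = 0" by (simp add: zero_prod_def scal_eval_0)
  have D_add: "?D (F + G) = ?D F + ?D G" for F G
    using D_emb[of "coords F + coords G"]
    by (simp add: emb_add deriv_coords_add[OF q] emb_coords flip: D_emb)
  have D_tscale: "?D (tscale p F) = tscale p (?D F)" for p F
    using D_emb[of "cscale [:[:p:]:] (coords F)"]
    by (simp add: deriv_coords_cscale[OF q] emb_coords flip: D_emb emb_tscale)
  have block: "Rt.subspace (block n)" for n
    unfolding block_def by (rule Rt.subspace_span)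
  have "?D 0 = 0" using D_add[of 0 0] by simp
  then have K: "Rt.subspace ?K"
    using block[of "k + 1"] by (auto simp: Rt.subspace_def D_add D_tscale)
  have R: "Rt.subspace (right_mult_x ` block k)"
  proof (rule Rt.subspaceI)
    show "0 \<in> right_mult_x ` block k"
      using Rt.subspace_0[OF block] by (force simp: right_mult_x_def)
  next
    fix F G assume "F \<in> right_mult_x ` block k" "G \<in> right_mult_x ` block k"
    then obtain F' G' where "F = F' * vx" "G = G' * vx" "F' \<in> block k" "G' \<in> block k"
      by (auto simp: right_mult_x_def)
    then show "F + G \<in> right_mult_x ` block k"
      using Rt.subspace_add[OF block] by (auto simp: right_mult_x_def simp flip: distrib_right)
  next
    fix p F assume "F \<in> right_mult_x ` block k"
    then obtain F' where "F = F' * vx" "F' \<in> block k"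
      by (auto simp: right_mult_x_def)
    then show "tscale p F \<in> right_mult_x ` block k"
      using Rt.subspace_scale[OF block, of F' k p]
      by (auto simp: right_mult_x_def tscale_def simp flip: mult.assoc)
  qed
  have R_block: "right_mult_x F \<in> block (k + 1)" if "F \<in> block k" for F
    using that homog_coords_right_x unfolding block_eq by (auto simp only: right_mult_x_emb)
  have inj: "F = 0" if F: "F \<in> block k" "?D (right_mult_x F) = 0" for F
  proof -
    obtain v where v: "F = emb v" "homog_coords k v" using F(1) unfolding block_eq by blast
    then have "deriv_coords q Q (right_x v) = 0"
      using F(2) by (simp only: right_mult_x_emb D_emb flip: emb_0) (simp only: emb_inj)
    then show ?thesis using deriv_right_x_inj[OF q Q v(2)] v(1) emb_0 by simp
  qed
  \<comment> \<open>The derivative of G lies in \<open>block k\<close>, and the composition maps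
    \<open>block k\<close> onto itself.\<close>
  have surj: "\<exists>F \<in> block k. ?D (right_mult_x F) = ?D G" if G: "G \<in> block (k + 1)" for G
  proof -
    obtain u where u: "G = emb u" "homog_coords (k + 1) u" using G unfolding block_eq by blast
    obtain v where "homog_coords k v" "deriv_coords q Q (right_x v) = deriv_coords q Q u"
      using deriv_right_x_surj[OF q Q homog_coords_deriv[OF q u(2)]] by blast
    then show ?thesis
      unfolding block_eq by (intro bexI[of _ "emb v"]) (simp_all only: right_mult_x_emb D_emb u, blast)
  qed
  \<comment> \<open>Taking F with F x and G having the same derivative, the remainder G - F x lies
    in the kernel.\<close>
  have "\<exists>H F. G = H + right_mult_x F \<and> H \<in> ?K \<and> F \<in> block k" if G: "G \<in> block (k + 1)" for G
  proof -
    obtain F where F: "F \<in> block k" "?D (right_mult_x F) = ?D G" using surj[OF G] by blast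
    have "?D (G - right_mult_x F) = 0"
      using D_add[of "G - right_mult_x F" "right_mult_x F"] F(2) by simp
    moreover have "G - right_mult_x F \<in> block (k + 1)"
      using Rt.subspace_diff[OF block G R_block[OF F(1)]] .
    ultimately show ?thesis
      using F(1) by (intro exI[of _ "G - right_mult_x F"] exI[of _ F]) simp
  qed
  moreover have "H + right_mult_x F \<in> block (k + 1)" if "H \<in> ?K" "F \<in> block k" for H F
    using that R_block Rt.subspace_add[OF block] by blast
  ultimately have "block (k + 1) = {a + b | a b. a \<in> ?K \<and> b \<in> right_mult_x ` block k}"
    by blast
  moreover have "?K \<inter> right_mult_x ` block k = {0}"
  proof -
    \<comment> \<open>An element F x of the kernel has F = 0 by injectivity of the
      composition.\<close>
    have "right_mult_x F = 0" if "F \<in> block k" "?D (right_mult_x F) = 0" for F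
      using inj[OF that] by (simp add: right_mult_x_def)
    then show ?thesis using Rt.subspace_0[OF K] Rt.subspace_0[OF R] by blast
  qed
  ultimately show ?thesis
    unfolding Rt_direct_sum_def by (intro conjI block K R)
qed

end
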